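(* Let $\nu\ge0$ and $\alpha\ge0$ satisfy $\nu^2+4\alpha^2\ge9$, and consider the complex KdV-Burgers problem $u_t-6uu_x+\alpha u_{xxx}-\nu u_{xx}=0$ for $x\in\mathbf{T}=\mathbf{R}/(2\pi\mathbf{Z})$, $t>0$, with $u(x,0)=u_0(x)$. If $$u_0(x)=a_{01}\,e^{ix}\quad\text{with}\quad |a_{01}|<1,$$ then the problem has a unique global solution, which can be represented in the form $u(x,t)=\sum_{k=1}^\infty a_k(t)e^{ikx}$. In addition, for any $s\ge0$, $u(\cdot,t)\in H^s(\mathbf{T})$ for all $t\ge0$.
   Context: $u$ is complex-valued and $2\pi$-periodic in $x$. For $u=\sum_{k\ge1}a_ke^{ikx}$, $u\in H^s(\mathbf{T})$ means $\|u\|_{H^s}^2=\sum_{k\ge1}(1+k^2)^s|a_k|^2<\infty$. *)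

theory Defs
  imports "HOL-Analysis.Analysis"
begin

text \<open>
  A function \<open>u x t\<close> is a global (classical) solution of
  \<open>u_t - 6 u u_x + \<alpha> u_xxx - \<nu> u_xx = 0\<close> on the circle with \<open>u(\<cdot>,0) = u0\<close>.
  It is complex-valued and \<open>2\<pi>\<close>-periodic in \<open>x\<close>; \<open>u\<close> and its first three space derivatives are
  continuous up to and including \<open>t = 0\<close>, and the equation holds pointwise for \<open>t > 0\<close> (so \<open>u_t\<close>
  is automatically continuous there). No Fourier representation is assumed.
  The values of \<open>u\<close> at negative times play no role.
\<close>

definition global_solution ::
  "real \<Rightarrow> real \<Rightarrow> (real \<Rightarrow> complex) \<Rightarrow> (real \<Rightarrow> real \<Rightarrow> complex) \<Rightarrow> bool" where
  "global_solution \<alpha> \<nu> u0 u \<longleftrightarrow>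
     (\<forall>t\<ge>0. \<forall>x. u (x + 2 * pi) t = u x t) \<and>
     (\<forall>x. u x 0 = u0 x) \<and>
     continuous_on (UNIV \<times> {0..}) (\<lambda>(x, t). u x t) \<and>
     (\<exists>ux uxx uxxx.
        continuous_on (UNIV \<times> {0..}) (\<lambda>(x, t). ux x t) \<and>
        continuous_on (UNIV \<times> {0..}) (\<lambda>(x, t). uxx x t) \<and>
        continuous_on (UNIV \<times> {0..}) (\<lambda>(x, t). uxxx x t) \<and>
        (\<forall>t\<ge>0. \<forall>x. ((\<lambda>y. u y t) has_vector_derivative ux x t) (at x)) \<and>
        (\<forall>t\<ge>0. \<forall>x. ((\<lambda>y. ux y t) has_vector_derivative uxx x t) (at x)) \<and>
        (\<forall>t\<ge>0. \<forall>x. ((\<lambda>y. uxx y t) has_vector_derivative uxxx x t) (at x)) \<and>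
        (\<forall>t>0. \<forall>x. \<exists>ut. ((\<lambda>\<tau>. u x \<tau>) has_vector_derivative ut) (at t) \<and>
           ut - 6 * u x t * ux x t + of_real \<alpha> * uxxx x t - of_real \<nu> * uxx x t = 0))"

text \<open>\<open>f(x) = \<Sum>\<^sub>k\<^sub>\<ge>\<^sub>1 a\<^sub>k e\<^sup>i\<^sup>k\<^sup>x\<close> for every \<open>x\<close>; \<open>has_sum\<close> makes the convergence absolute.\<close>

definition has_positive_fourier_series :: "(real \<Rightarrow> complex) \<Rightarrow> (nat \<Rightarrow> complex) \<Rightarrow> bool" where
  "has_positive_fourier_series f a \<longleftrightarrow>
     (\<forall>x. ((\<lambda>k. a k * exp (\<i> * of_nat k * of_real x)) has_sum f x) {1..})"

text \<open>
  Membership in \<open>H\<^sup>s(T)\<close> for functions with positive frequencies only. The series is required to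
  converge pointwise and absolutely rather than in the sense of \<open>L\<^sup>2\<close>; this is automatic
  (up to null sets) for \<open>s > 1/2\<close>, and asks for more when \<open>0 \<le> s \<le> 1/2\<close>. The coefficients \<open>a\<close> are
  determined by \<open>f\<close>.
\<close>

definition in_Hs :: "real \<Rightarrow> (real \<Rightarrow> complex) \<Rightarrow> bool" where
  "in_Hs s f \<longleftrightarrow>
     (\<exists>a. has_positive_fourier_series f a \<and>
          (\<lambda>k. (1 + (real k)\<^sup>2) powr s * (cmod (a k))\<^sup>2) summable_on {1..})"

end

theory Submission
  imports Defs
begin

text \<open>
  The Fourier modes solve a triangular system of linear equations, and everything rests on the
  bound \<open>|a\<^sub>k(t)| \<le> B k |a\<^sub>0\<^sub>1|\<^sup>k\<close>, uniformly in \<open>t \<ge> 0\<close>. Put \<open>y = e\<^sup>-\<^sup>\<nu>\<^sup>t\<close>. There are two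
  ways to estimate \<open>a\<^sub>k\<close>, and \<open>\<nu>\<^sup>2 + 4\<alpha>\<^sup>2 \<ge> 9\<close> guarantees that at each time one of them suffices.
  Dispersion: \<open>a\<^sub>k\<close> is a finite sum of exponentials, and since the frequencies satisfy
  \<open>k\<^sup>3 - j\<^sup>3 - (k-j)\<^sup>3 = 3kj(k-j)\<close>, the recursion for the sums of the moduli of the coefficients
  gains a factor \<open>1/(j(k-j))\<close>; this is good for \<open>2y\<^sup>2 \<le> \<alpha>\<^sup>2\<close>. Dissipation: the functions
  \<open>|a\<^sub>0\<^sub>1|\<^sup>k y\<^sup>k (3/\<nu>)\<^sup>k\<^sup>-\<^sup>1 (1-y\<^sup>2)\<^sup>k\<^sup>/\<^sup>2\<close> for \<open>k \<ge> 2\<close> form a supersolution; this is good for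
  \<open>y\<^sup>2(1-y\<^sup>2) \<le> \<nu>\<^sup>2/9\<close>. Uniqueness holds among all classical solutions, by an energy estimate for
  the difference of the antiderivatives in \<open>x\<close>, which are periodic because the mean vanishes.
\<close>

section \<open>Duhamel's formula and the Fourier mode system\<close>

text \<open>Neither estimate covers all times. For \<alpha>^2 < 2 the dispersive condition fails at
  t = 0; for 0 < \<nu> < 3/2 the dissipative one fails when y^2 = 1/2. But the dissipative condition
  also holds near t = 0, because the modes k \<ge> 2 start from zero. This is how the two fit
  together: where the dispersive condition fails, \<alpha>^2 < 2 y^2 turns the hypothesis into 9 -
  \<nu>^2 < 8 y^2, that is 1 - y^2 < (\<nu>^2 - 1)/8, and the right-hand side is at most \<nu>^2/9
  as long as \<nu>^2 \<le> 9. For \<nu> \<ge> 3/2 the trivial bound y^2 (1 - y^2) \<le> 1/4 is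
  enough.

  The constants in both thresholds come from the mode k = 2, which fixes the normalisation of both
  recursions. The geometric ratio has to be |a01| without any loss, since |a01| may be arbitrarily
  close to 1; the constant B and the factor k cost nothing, because the geometric factor absorbs
  every power of k that differentiation in x or t produces.\<close>

definition duhamel :: "complex \<Rightarrow> (real \<Rightarrow> complex) \<Rightarrow> real \<Rightarrow> complex" where
  "duhamel l f t = exp (l * of_real t) * integral {0..t} (\<lambda>s. exp (- (l * of_real s)) * f s)"

lemma duhamel_0 [simp]: "duhamel l f 0 = 0"
  by (simp add: duhamel_def)

lemma exp_line_has_vector_derivative:
  "((\<lambda>t. exp (l * of_real t)) has_vector_derivative l * exp (l * of_real t)) (at t within S)"
  for l :: complex
proof -
  have "((\<lambda>z. exp (l * z)) has_field_derivative l * exp (l * of_real t)) (at (of_real t))"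
    by (auto intro!: derivative_eq_intros)
  from has_vector_derivative_real_field[OF this] show ?thesis
    by (rule has_vector_derivative_at_within)
qed

lemma duhamel_has_vector_derivative:
  assumes f: "continuous_on {0..} f" and t: "t \<ge> 0"
  shows "(duhamel l f has_vector_derivative l * duhamel l f t + f t) (at t within {0..})"
proof -
  have c: "continuous_on {0..t+1} (\<lambda>s. exp (- (l * of_real s)) * f s)"
    by (intro continuous_intros continuous_on_subset[OF f]) auto
  have "at t within {0..t+1} = at t within {0..}"
    by (rule at_within_nhd[where S="{..<t+1}"]) auto
  with integral_has_vector_derivative[OF c, of t] t
  have I: "((\<lambda>u. integral {0..u} (\<lambda>s. exp (- (l * of_real s)) * f s)) has_vector_derivative
      exp (- (l * of_real t)) * f t) (at t within {0..})" by simp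
  have "(duhamel l f has_vector_derivative
      exp (l * of_real t) * (exp (- (l * of_real t)) * f t) +
      l * exp (l * of_real t) * integral {0..t} (\<lambda>s. exp (- (l * of_real s)) * f s))
      (at t within {0..})"
    unfolding duhamel_def[abs_def]
    by (rule has_vector_derivative_mult[OF exp_line_has_vector_derivative I])
  then show ?thesis
    by (simp add: duhamel_def mult.assoc[symmetric] exp_add[symmetric] add.commute)
qed

lemma integrating_factor_has_vector_derivative:
  fixes l :: complex
  assumes "(F has_vector_derivative l * F t + g) (at t within S)"
  shows "((\<lambda>t. exp (- l * of_real t) * F t) has_vector_derivative exp (- l * of_real t) * g)
    (at t within S)"
  using has_vector_derivative_mult[OF exp_line_has_vector_derivative[of "-l" t S] assms]
  by (simp add: algebra_simps)

lemma linear_ode_unique: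
  fixes F G f :: "real \<Rightarrow> complex"
  assumes F: "\<And>t. t \<ge> 0 \<Longrightarrow> (F has_vector_derivative l * F t + f t) (at t within {0..})"
    and G: "\<And>t. t \<ge> 0 \<Longrightarrow> (G has_vector_derivative l * G t + f t) (at t within {0..})"
    and "F 0 = G 0" and t: "t \<ge> 0"
  shows "F t = G t"
proof -
  let ?D = "\<lambda>t. F t - G t"
  have "((\<lambda>t. exp (- l * of_real t) * ?D t) has_vector_derivative 0) (at t within {0..})"
    if "t \<ge> 0" for t
    using integrating_factor_has_vector_derivative[of ?D l t 0 "{0..}"]
      has_vector_derivative_diff[OF F[OF that] G[OF that]]
    by (simp add: algebra_simps)
  then obtain c where c: "\<And>t. t \<ge> 0 \<Longrightarrow> exp (- l * of_real t) * ?D t = c"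
    by (rule has_vector_derivative_zero_constant[of "{0..}", rotated]) auto
  have "c = 0" using c[of 0] \<open>F 0 = G 0\<close> by simp
  with c[OF t] show ?thesis by simp
qed

section \<open>The system of ordinary differential equations for the Fourier modes\<close>

definition symb :: "real \<Rightarrow> real \<Rightarrow> nat \<Rightarrow> complex" where
  "symb \<alpha> \<nu> k = Complex (- \<nu> * (real k)\<^sup>2) (\<alpha> * (real k)^3)"

text \<open>The k-th Fourier coefficient of 6 u u_x = 3 (u^2)_x. Leaving out j = 0 and j = k,
  harmless for a series without constant mode, makes it depend on the modes below k only.\<close>

definition mode_source :: "(nat \<Rightarrow> real \<Rightarrow> complex) \<Rightarrow> nat \<Rightarrow> real \<Rightarrow> complex" where
  "mode_source a k t = 3 * \<i> * of_nat k * (\<Sum>j=1..<k. a j t * a (k - j) t)"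

definition mode_system :: "real \<Rightarrow> real \<Rightarrow> complex \<Rightarrow> (nat \<Rightarrow> real \<Rightarrow> complex) \<Rightarrow> bool" where
  "mode_system \<alpha> \<nu> A a \<longleftrightarrow>
     (\<forall>t. a 0 t = 0) \<and> (\<forall>k. a k 0 = (if k = 1 then A else 0)) \<and>
     (\<forall>k. \<forall>t\<ge>0. (a k has_vector_derivative symb \<alpha> \<nu> k * a k t + mode_source a k t)
        (at t within {0..}))"

text \<open>The clause k = 1 is the free evolution of the datum; every higher mode starts from zero
  and is therefore a bare Duhamel integral of its source.\<close>

function mode_sol :: "(nat \<Rightarrow> complex) \<Rightarrow> complex \<Rightarrow> nat \<Rightarrow> real \<Rightarrow> complex" where
  "mode_sol l A k =
     (if k = 0 then (\<lambda>t. 0)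
      else if k = 1 then (\<lambda>t. A * exp (l 1 * of_real t))
      else duhamel (l k) (\<lambda>t. 3 * \<i> * of_nat k *
             (\<Sum>j=1..<k. mode_sol l A j t * mode_sol l A (k - j) t)))"
  by auto
termination by (relation "Wellfounded.measure (\<lambda>(l, A, k). k)") auto

declare mode_sol.simps [simp del]

lemma mode_system_exists: "\<exists>a. mode_system \<alpha> \<nu> A a"
proof
  let ?l = "symb \<alpha> \<nu>"
  let ?a = "mode_sol ?l A"
  have d: "\<forall>t\<ge>0. (?a k has_vector_derivative ?l k * ?a k t + mode_source ?a k t)
      (at t within {0..})" for k
  proof (induction k rule: less_induct)
    case (less k)
    consider "k = 0" | "k = 1" | "k \<ge> 2" by linarith
    then show ?case
    proof cases
      case 1
      then show ?thesis by (simp add: mode_sol.simps mode_source_def)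
    next
      case 2
      have "?a 1 = (\<lambda>t. A * exp (?l 1 * of_real t))" by (simp add: mode_sol.simps)
      moreover have "((\<lambda>t. A * exp (?l 1 * of_real t)) has_vector_derivative
          A * (?l 1 * exp (?l 1 * of_real t))) (at t within {0..})" for t
        by (intro has_vector_derivative_mult_right exp_line_has_vector_derivative)
      ultimately show ?thesis using 2 by (simp add: mode_source_def ac_simps)
    next
      case 3
      \<comment> \<open>The induction hypothesis makes the lower modes differentiable, hence the
        source continuous, which is what differentiating the Duhamel integral requires.\<close>
      have c: "continuous_on {0..} (?a j)" if "j < k" for j
        using less[OF that] has_vector_derivative_continuous
        by (fastforce simp: continuous_on_eq_continuous_within)
      have "continuous_on {0..} (mode_source ?a k)"
        unfolding mode_source_def by (intro continuous_intros c) auto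
      moreover have "?a k = duhamel (?l k) (mode_source ?a k)"
        using 3 by (subst mode_sol.simps) (simp add: mode_source_def[abs_def])
      ultimately show ?thesis using duhamel_has_vector_derivative by metis
    qed
  qed
  have "?a k 0 = (if k = 1 then A else 0)" for k
    by (simp add: mode_sol.simps[of _ _ k])
  then show "mode_system \<alpha> \<nu> A ?a"
    unfolding mode_system_def using d by (simp add: mode_sol.simps[of _ _ 0])
qed

section \<open>Finite exponential sums with controlled coefficients and exponents\<close>

text \<open>The exponents are recorded as \<open>-\<nu>S + i\<alpha>P\<close>; in the application \<open>S\<close> and \<open>P\<close> are the
  sums of the squares and of the cubes of the parts of a partition of \<open>k\<close>.\<close>

inductive exp_sum :: "real \<Rightarrow> real \<Rightarrow> real \<Rightarrow> real \<Rightarrow> real \<Rightarrow> (real \<Rightarrow> complex) \<Rightarrow> bool"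
  for \<alpha> \<nu> p s where
  single: "P \<le> p \<Longrightarrow> s \<le> S \<Longrightarrow> cmod c \<le> M \<Longrightarrow>
    exp_sum \<alpha> \<nu> p s M (\<lambda>t. c * exp (Complex (- \<nu> * S) (\<alpha> * P) * of_real t))"
| add: "exp_sum \<alpha> \<nu> p s M f \<Longrightarrow> exp_sum \<alpha> \<nu> p s N g \<Longrightarrow> exp_sum \<alpha> \<nu> p s (M + N) (\<lambda>t. f t + g t)"

lemma exp_sum_zero: "0 \<le> M \<Longrightarrow> exp_sum \<alpha> \<nu> p s M (\<lambda>t. 0)"
  using exp_sum.single[of p p s s 0 M \<alpha> \<nu>] by simp

lemma exp_sum_mono:
  assumes "exp_sum \<alpha> \<nu> p s M f" "M \<le> N"
  shows "exp_sum \<alpha> \<nu> p s N f"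
  using exp_sum.add[OF assms(1) exp_sum_zero[of "N - M"]] assms(2) by simp

lemma exp_sum_sum:
  assumes "finite J" "\<And>j. j \<in> J \<Longrightarrow> exp_sum \<alpha> \<nu> p s (M j) (f j)"
  shows "exp_sum \<alpha> \<nu> p s (\<Sum>j\<in>J. M j) (\<lambda>t. \<Sum>j\<in>J. f j t)"
  using assms by (induction J) (auto intro: exp_sum_zero exp_sum.add)

lemma exp_sum_cmult:
  assumes "exp_sum \<alpha> \<nu> p s M f"
  shows "exp_sum \<alpha> \<nu> p s (cmod c * M) (\<lambda>t. c * f t)"
  using assms
proof induction
  case (single P S d M)
  then show ?case
    using exp_sum.single[of P p s S "c * d" "cmod c * M" \<alpha> \<nu>]
    by (simp add: norm_mult mult_left_mono mult.assoc)
next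
  case (add M f N g)
  then show ?case using exp_sum.add by (fastforce simp: distrib_left)
qed

text \<open>Exponents add under multiplication, so the frequency bound and the decay rate are
  additive, while the sum of the moduli is submultiplicative.\<close>

lemma exp_sum_mult:
  assumes f: "exp_sum \<alpha> \<nu> p s M f" and g: "exp_sum \<alpha> \<nu> q r N g"
  shows "exp_sum \<alpha> \<nu> (p + q) (s + r) (M * N) (\<lambda>t. f t * g t)"
  using f
proof induction
  case 1: (single P S c M)
  show ?case using g
  proof induction
    case (single Q R d N)
    have "Complex (- \<nu> * S) (\<alpha> * P) + Complex (- \<nu> * R) (\<alpha> * Q) =
        Complex (- \<nu> * (S + R)) (\<alpha> * (P + Q))"
      by (simp add: complex_eq_iff algebra_simps)
    then have "c * exp (Complex (- \<nu> * S) (\<alpha> * P) * of_real t) *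
        (d * exp (Complex (- \<nu> * R) (\<alpha> * Q) * of_real t)) =
        c * d * exp (Complex (- \<nu> * (S + R)) (\<alpha> * (P + Q)) * of_real t)" for t
      by (metis (no_types, lifting) distrib_right exp_add mult.assoc mult.left_commute)
    moreover have "cmod (c * d) \<le> M * N"
      unfolding norm_mult using 1 single
      by (intro mult_mono) (auto intro: order_trans[OF norm_ge_zero])
    ultimately show ?case
      using 1 single by (simp only:) (intro exp_sum.single, auto)
  next
    case (add M f N g)
    then show ?case using exp_sum.add by (fastforce simp: distrib_left)
  qed
next
  case (add M f N g)
  then show ?case using exp_sum.add by (fastforce simp: distrib_right)
qed

lemma exp_sum_norm_le:
  assumes "exp_sum \<alpha> \<nu> p s M f" "\<nu> \<ge> 0" "t \<ge> 0"
  shows "cmod (f t) \<le> M * exp (- \<nu> * s * t)"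
  using assms(1)
proof induction
  case (single P S c M)
  have "\<nu> * s * t \<le> \<nu> * S * t" using assms single by (intro mult_right_mono mult_left_mono) auto
  moreover have "0 \<le> M" using single norm_ge_zero order_trans by blast
  ultimately show ?case using single by (auto simp: norm_mult intro!: mult_mono)
next
  case (add M f N g)
  then show ?case by (smt (verit) distrib_right norm_triangle_ineq)
qed

text \<open>The two exponentials of the Duhamel integral account for the factor 2, and \<open>\<alpha>(q - p)\<close>
  bounds the denominators from below.\<close>

lemma exp_sum_duhamel:
  assumes f: "exp_sum \<alpha> \<nu> p s M f" and "p < q" "s \<le> r" "\<alpha> > 0"
  shows "\<exists>F. exp_sum \<alpha> \<nu> q s (2 * M / (\<alpha> * (q - p))) F \<and> F 0 = 0 \<and>
    (\<forall>t. (F has_vector_derivative Complex (- \<nu> * r) (\<alpha> * q) * F t + f t) (at t within {0..}))"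
  using f
proof induction
  case (single P S c M)
  let ?m = "Complex (- \<nu> * r) (\<alpha> * q)" and ?l = "Complex (- \<nu> * S) (\<alpha> * P)"
  \<comment> \<open>For the source c e^(lt) and zero initial value the solution is c (e^(lt) -
    e^(mt)) / (l - m). The denominator is bounded below through imaginary parts alone, so the gain
    does not depend on \<nu>.\<close>
  define d where "d = c / (?l - ?m)"
  have "\<alpha> * (q - p) \<le> \<alpha> * (q - P)" using assms single by auto
  also have "\<dots> = \<bar>Im (?l - ?m)\<bar>" using assms single by (simp add: abs_if algebra_simps)
  also have "\<dots> \<le> cmod (?l - ?m)" by (rule abs_Im_le_cmod)
  finally have le: "\<alpha> * (q - p) \<le> cmod (?l - ?m)" .
  moreover have pos: "\<alpha> * (q - p) > 0" using assms by simp
  ultimately have "?l - ?m \<noteq> 0" by auto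
  then have dc: "d * (?l - ?m) = c" by (simp add: d_def)
  have "0 \<le> M" using single norm_ge_zero order_trans by blast
  then have d: "cmod d \<le> M / (\<alpha> * (q - p))"
    unfolding d_def norm_divide using le pos single by (intro frac_le) auto
  let ?F = "\<lambda>t. d * exp (?l * of_real t) + - d * exp (?m * of_real t)"
  have "exp_sum \<alpha> \<nu> q s (M / (\<alpha> * (q - p)) + M / (\<alpha> * (q - p))) ?F"
    using assms single d by (intro exp_sum.add exp_sum.single) auto
  then have "exp_sum \<alpha> \<nu> q s (2 * M / (\<alpha> * (q - p))) ?F" by simp
  moreover have "(?F has_vector_derivative ?m * ?F t + c * exp (?l * of_real t))
      (at t within {0..})" for t
  proof -
    have "(?F has_vector_derivative d * (?l * exp (?l * of_real t)) + - d * (?m * exp (?m * of_real t)))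
        (at t within {0..})"
      by (intro has_vector_derivative_add has_vector_derivative_mult_right
          exp_line_has_vector_derivative)
    then show ?thesis unfolding dc[symmetric] by (simp add: algebra_simps)
  qed
  ultimately show ?case by (intro exI[of _ ?F]) auto
next
  case (add M f N g)
  then obtain F G where
    F: "exp_sum \<alpha> \<nu> q s (2 * M / (\<alpha> * (q - p))) F" "F 0 = 0"
       "\<And>t. (F has_vector_derivative Complex (- \<nu> * r) (\<alpha> * q) * F t + f t) (at t within {0..})" and
    G: "exp_sum \<alpha> \<nu> q s (2 * N / (\<alpha> * (q - p))) G" "G 0 = 0"
       "\<And>t. (G has_vector_derivative Complex (- \<nu> * r) (\<alpha> * q) * G t + g t) (at t within {0..})"
    by blast
  show ?case
    using exp_sum.add[OF F(1) G(1)] F(2) G(2) has_vector_derivative_add[OF F(3) G(3)]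
    by (intro exI[of _ "\<lambda>t. F t + G t"]) (auto simp: algebra_simps add_divide_distrib)
qed

section \<open>Bounds on the Fourier modes\<close>

text \<open>Both mode bounds are geometric up to an exceptional value at j = 1: this is used with c
  = sqrt 2, d = 1 and with c = 1, d = \<open>h t\<close>. Only the terms j = 1 and j = k - 1 see the
  exception, and for k = 2 these coincide.\<close>

lemma convolution_geometric_except_first:
  fixes c d :: real and k :: nat
  assumes "k \<ge> 2"
  defines "n \<equiv> \<lambda>j::nat. if j = 1 then c else d ^ j"
  shows "(\<Sum>j=1..<k. n j * n (k - j)) =
    (if k = 2 then c\<^sup>2 else 2 * c * d ^ (k - 1) + (real k - 3) * d ^ k)"
proof (cases "k = 2")
  case True
  have "{1..<2::nat} = {1}" by auto
  then show ?thesis using True by (simp add: n_def power2_eq_square)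
next
  case False
  then have k: "k \<ge> 3" using assms by auto
  have "{1..<k} = insert 1 (insert (k - 1) {2..<k-1})" using k by auto
  then have "(\<Sum>j=1..<k. n j * n (k - j)) =
      n 1 * n (k - 1) + n (k - 1) * n 1 + (\<Sum>j=2..<k-1. n j * n (k - j))"
    using k by simp
  also have "(\<Sum>j=2..<k-1. n j * n (k - j)) = (\<Sum>j=2..<k-1. d ^ k)"
    by (rule sum.cong) (use k in \<open>auto simp: n_def power_add[symmetric]\<close>)
  also have "\<dots> = (real k - 3) * d ^ k" using k by (simp add: of_nat_diff)
  finally have "(\<Sum>j=1..<k. n j * n (k - j)) = 2 * (n 1 * n (k - 1)) + (real k - 3) * d ^ k"
    by simp
  moreover have "n (k - 1) = d ^ (k - 1)" "n 1 = c" using k by (auto simp: n_def)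
  ultimately show ?thesis using False by simp
qed

section \<open>First mode and dispersive estimate\<close>

lemma mode_systemD:
  assumes "mode_system \<alpha> \<nu> A a"
  shows "a 0 t = 0" "a k 0 = (if k = 1 then A else 0)"
    and "t \<ge> 0 \<Longrightarrow> (a k has_vector_derivative symb \<alpha> \<nu> k * a k t + mode_source a k t)
      (at t within {0..})"
  using assms unfolding mode_system_def by auto

lemma first_mode:
  assumes a: "mode_system \<alpha> \<nu> A a" and "t \<ge> 0"
  shows "a 1 t = A * exp (Complex (- \<nu>) \<alpha> * of_real t)"
proof (rule linear_ode_unique[where l="symb \<alpha> \<nu> 1" and f="\<lambda>_. 0", OF _ _ _ \<open>t \<ge> 0\<close>])
  fix t :: real assume "t \<ge> 0"
  show "(a 1 has_vector_derivative symb \<alpha> \<nu> 1 * a 1 t + 0) (at t within {0..})"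
    using mode_systemD(3)[OF a \<open>t \<ge> 0\<close>, of 1] by (simp add: mode_source_def)
  show "((\<lambda>t. A * exp (Complex (- \<nu>) \<alpha> * of_real t)) has_vector_derivative
      symb \<alpha> \<nu> 1 * (A * exp (Complex (- \<nu>) \<alpha> * of_real t)) + 0) (at t within {0..})"
    using has_vector_derivative_mult_right[OF exp_line_has_vector_derivative[of "Complex (- \<nu>) \<alpha>" t "{0..}"], of A]
    by (simp add: symb_def ac_simps)
qed (use mode_systemD(2)[OF a, of 1] in simp)

text \<open>The sums of moduli obey M k = (2/\<alpha>) \<Sum> (M j / j) (M (k-j) / (k-j)), because
  the frequency gap cancels the factor 3k of the source. A separate \<open>f\<close> appears since
  \<open>exp_sum\<close> speaks of all real t, whereas the mode is determined for t \<ge> 0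
  only.\<close>

lemma mode_exp_sum:
  assumes a: "mode_system \<alpha> \<nu> A a" and "\<alpha> > 0" "k \<ge> 1"
  shows "\<exists>f. (\<forall>t\<ge>0. a k t = f t) \<and>
    exp_sum \<alpha> \<nu> (real k ^ 3) (real k)
      (\<alpha> / 2 * real k * (cmod A * sqrt 2 / \<alpha>) ^ k * (if k = 1 then sqrt 2 else 1)) f"
  using \<open>k \<ge> 1\<close>
proof (induction k rule: less_induct)
  case (less k)
  \<comment> \<open>With M j = (\<alpha>/2) j q^j n j the recursion closes if \<Sum> n j * n (k - j)
    \<le> k for k \<ge> 2. For k = 2 this reads (n 1)^2 \<le> 2. Since M 1 = |A| forces q = 2 |A| /
    (\<alpha> * n 1), the largest admissible value sqrt 2 gives the smallest ratio q.\<close>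
  define n where "n j = (if j = 1 then sqrt 2 else 1 ^ j)" for j :: nat
  define q where "q = cmod A * sqrt 2 / \<alpha>"
  define M where "M j = \<alpha> / 2 * real j * q ^ j * n j" for j
  show ?case
  proof (cases "k = 1")
    case True
    have "\<alpha> / 2 * real k * q ^ k * sqrt 2 = cmod A"
      using True \<open>\<alpha> > 0\<close> by (simp add: q_def field_simps)
    moreover have "exp_sum \<alpha> \<nu> (real 1 ^ 3) (real 1) (cmod A)
        (\<lambda>t. A * exp (Complex (- \<nu> * 1) (\<alpha> * 1) * of_real t))"
      by (rule exp_sum.single) auto
    ultimately show ?thesis
      using first_mode[OF a] True unfolding q_def by auto
  next
    case False
    with less.prems have k: "k \<ge> 2" by simp
    let ?J = "{1..<k}"
    let ?l = "Complex (- \<nu> * (real k)\<^sup>2) (\<alpha> * real k ^ 3)"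
    define T where "T j t = 3 * \<i> * of_nat k * (a j t * a (k - j) t)" for j t
    have "\<exists>F. exp_sum \<alpha> \<nu> (real k ^ 3) (real k) (\<alpha> / 2 * q ^ k * (n j * n (k - j))) F \<and> F 0 = 0 \<and>
        (\<forall>t\<ge>0. (F has_vector_derivative ?l * F t + T j t) (at t within {0..}))"
      if j: "j \<in> ?J" for j
    proof -
      let ?i = "k - j"
      have n1: "n i = (if i = 1 then sqrt 2 else 1)" for i by (simp add: n_def)
      have "\<exists>f. (\<forall>t\<ge>0. a i t = f t) \<and> exp_sum \<alpha> \<nu> (real i ^ 3) (real i) (M i) f"
        if "i < k" "i \<ge> 1" for i
        using less.IH[OF that] unfolding M_def n1 q_def .
      from this[of j] this[of ?i] j
      obtain f g where f: "\<forall>t\<ge>0. a j t = f t" "exp_sum \<alpha> \<nu> (real j ^ 3) (real j) (M j) f"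
        and g: "\<forall>t\<ge>0. a ?i t = g t" "exp_sum \<alpha> \<nu> (real ?i ^ 3) (real ?i) (M ?i) g"
        by force
      let ?p = "real j ^ 3 + real ?i ^ 3"
      have ki: "real k = real j + real ?i" using j by auto
      have "exp_sum \<alpha> \<nu> ?p (real k) (cmod (3 * \<i> * of_nat k) * (M j * M ?i))
          (\<lambda>t. 3 * \<i> * of_nat k * (f t * g t))"
        unfolding ki by (intro exp_sum_cmult exp_sum_mult f g)
      moreover have diff: "real k ^ 3 - ?p = 3 * real k * real j * real ?i"
        unfolding ki by (simp add: power3_eq_cube algebra_simps)
      moreover have "3 * real k * real j * real ?i > 0" using j by simp
      \<comment> \<open>The free exponential of mode k decays at rate \<nu> k^2, hence at least at
        the rate \<nu> k inherited from the product.\<close>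
      moreover have "real k \<le> (real k)\<^sup>2" using k by (simp add: power2_eq_square)
      ultimately obtain F where
        F: "exp_sum \<alpha> \<nu> (real k ^ 3) (real k)
              (2 * (cmod (3 * \<i> * of_nat k) * (M j * M ?i)) / (\<alpha> * (real k ^ 3 - ?p))) F"
           "F 0 = 0"
           "\<forall>t. (F has_vector_derivative ?l * F t + 3 * \<i> * of_nat k * (f t * g t)) (at t within {0..})"
        using exp_sum_duhamel[of \<alpha> \<nu> ?p "real k" _ _ "real k ^ 3" "(real k)\<^sup>2"] \<open>\<alpha> > 0\<close>
        by (smt (verit, ccfv_threshold))
      have "2 * (3 * K * (\<alpha> / 2 * x * u * v * (\<alpha> / 2 * y * u' * v'))) / (\<alpha> * (3 * K * x * y)) =
          \<alpha> / 2 * (u * u') * (v * v')" if "K > 0" "x > 0" "y > 0" for K x y u u' v v' :: real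
        using that \<open>\<alpha> > 0\<close> by (simp add: field_simps)
      from this[of "real k" "real j" "real ?i" "q ^ j" "n j" "q ^ ?i" "n ?i"] j k
      have "2 * (cmod (3 * \<i> * of_nat k) * (M j * M ?i)) / (\<alpha> * (real k ^ 3 - ?p)) =
          \<alpha> / 2 * q ^ (j + ?i) * (n j * n ?i)"
        unfolding diff M_def power_add by (simp add: norm_mult del: of_nat_diff)
      then have "2 * (cmod (3 * \<i> * of_nat k) * (M j * M ?i)) / (\<alpha> * (real k ^ 3 - ?p)) =
          \<alpha> / 2 * q ^ k * (n j * n ?i)" using j by simp
      with F f(1) g(1) show ?thesis unfolding T_def by (intro exI[of _ F]) auto
    qed
    then obtain F where F:
      "\<And>j. j \<in> ?J \<Longrightarrow> exp_sum \<alpha> \<nu> (real k ^ 3) (real k) (\<alpha> / 2 * q ^ k * (n j * n (k - j))) (F j)"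
      "\<And>j. j \<in> ?J \<Longrightarrow> F j 0 = 0"
      "\<And>j t. j \<in> ?J \<Longrightarrow> t \<ge> 0 \<Longrightarrow> (F j has_vector_derivative ?l * F j t + T j t) (at t within {0..})"
      by metis
    let ?S = "\<lambda>t. \<Sum>j\<in>?J. F j t"
    have "exp_sum \<alpha> \<nu> (real k ^ 3) (real k) (\<Sum>j\<in>?J. \<alpha> / 2 * q ^ k * (n j * n (k - j))) ?S"
      by (intro exp_sum_sum F) auto
    moreover have "(\<Sum>j\<in>?J. \<alpha> / 2 * q ^ k * (n j * n (k - j))) \<le> \<alpha> / 2 * q ^ k * real k"
    proof -
      \<comment> \<open>For k \<ge> 3 the convolution equals 2 sqrt 2 + k - 3; for k = 2 it is
        exactly 2.\<close>
      have "sqrt 2 \<le> 3 / 2" by (rule real_le_lsqrt) (auto simp: power2_eq_square)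
      then have "(\<Sum>j\<in>?J. n j * n (k - j)) \<le> real k"
        unfolding n_def convolution_geometric_except_first[OF k] by auto
      then show ?thesis
        unfolding sum_distrib_left[symmetric] using \<open>\<alpha> > 0\<close> by (intro mult_left_mono) (auto simp: q_def)
    qed
    ultimately have "exp_sum \<alpha> \<nu> (real k ^ 3) (real k) (\<alpha> / 2 * q ^ k * real k) ?S"
      by (rule exp_sum_mono)
    moreover have "a k t = ?S t" if "t \<ge> 0" for t
    proof (rule linear_ode_unique[where l="?l" and f="mode_source a k", OF _ _ _ that])
      fix t :: real assume t: "t \<ge> 0"
      show "(a k has_vector_derivative ?l * a k t + mode_source a k t) (at t within {0..})"
        using mode_systemD(3)[OF a t] by (simp add: symb_def)
      have "?l * ?S t + mode_source a k t = (\<Sum>j\<in>?J. ?l * F j t + T j t)"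
        by (simp add: sum.distrib sum_distrib_left mode_source_def T_def)
      then show "(?S has_vector_derivative ?l * ?S t + mode_source a k t) (at t within {0..})"
        using F(3) t by (auto intro!: has_vector_derivative_sum)
    qed (use mode_systemD(2)[OF a, of k] F(2) k in auto)
    ultimately show ?thesis
      using False by (intro exI[of _ ?S]) (simp add: q_def ac_simps)
  qed
qed

text \<open>The coefficients grow like (sqrt 2 |A| / \<alpha>)^k and the common decay contributes
  y^k with y = exp (- \<nu> t); the product stays below |A|^k as soon as sqrt 2 y \<le>
  \<alpha>.\<close>

lemma mode_bound_dispersive:
  assumes a: "mode_system \<alpha> \<nu> A a" and "\<alpha> > 0" "\<nu> \<ge> 0" "k \<ge> 1" "t \<ge> 0"
    and small: "2 * exp (- (2 * \<nu> * t)) \<le> \<alpha>\<^sup>2"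
  shows "cmod (a k t) \<le> (1 + \<alpha> / 2) * real k * cmod A ^ k"
proof -
  define y where "y = exp (- (\<nu> * t))"
  let ?q = "cmod A * sqrt 2 / \<alpha>"
  let ?M = "\<lambda>k. \<alpha> / 2 * real k * ?q ^ k * (if k = 1 then sqrt 2 else 1)"
  have "y\<^sup>2 = exp (- (2 * \<nu> * t))"
    unfolding y_def exp_double[symmetric] by (simp add: mult.assoc)
  then have "(sqrt 2 * y)\<^sup>2 \<le> \<alpha>\<^sup>2"
    using small by (simp add: power_mult_distrib)
  then have qy: "sqrt 2 / \<alpha> * y \<le> 1" "sqrt 2 / \<alpha> * y \<ge> 0"
    using \<open>\<alpha> > 0\<close> power2_le_imp_le[of "sqrt 2 * y" \<alpha>] by (auto simp: y_def field_simps)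
  obtain f where "a k t = f t" "exp_sum \<alpha> \<nu> (real k ^ 3) (real k) (?M k) f"
    using mode_exp_sum[OF a \<open>\<alpha> > 0\<close> \<open>k \<ge> 1\<close>] \<open>t \<ge> 0\<close> by auto
  then have "cmod (a k t) \<le> ?M k * exp (- \<nu> * real k * t)"
    using exp_sum_norm_le \<open>\<nu> \<ge> 0\<close> \<open>t \<ge> 0\<close> by metis
  also have e: "exp (- \<nu> * real k * t) = y ^ k"
    unfolding y_def exp_of_nat_mult[symmetric] by (simp add: ac_simps)
  also have "?M k * y ^ k \<le> (1 + \<alpha> / 2) * real k * cmod A ^ k"
  proof (cases "k = 1")
    case True
    have "cmod A * y \<le> cmod A" using \<open>\<nu> \<ge> 0\<close> \<open>t \<ge> 0\<close> by (simp add: y_def mult_left_le)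
    also have "\<dots> \<le> (1 + \<alpha> / 2) * cmod A" using \<open>\<alpha> > 0\<close> by (simp add: algebra_simps)
    finally show ?thesis using True \<open>\<alpha> > 0\<close> by (simp add: field_simps)
  next
    case False
    have "?M k * y ^ k = \<alpha> / 2 * real k * cmod A ^ k * (sqrt 2 / \<alpha> * y) ^ k"
      using False by (simp add: power_mult_distrib power_divide)
    also have "\<dots> \<le> \<alpha> / 2 * real k * cmod A ^ k * 1"
      using qy \<open>\<alpha> > 0\<close> by (intro mult_left_mono power_le_one) auto
    also have "\<dots> \<le> (1 + \<alpha> / 2) * real k * cmod A ^ k"
      using \<open>\<alpha> > 0\<close> by (simp add: algebra_simps)
    finally show ?thesis .
  qed
  finally show ?thesis .
qed

text \<open>For \<alpha> = 0 and k = 2 this is an equality: with y = exp (- \<nu> t) the second mode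
  is then 3 i A^2 y^2 (1 - y^2) / \<nu>, which is the origin of \<open>h\<close> and of 3/\<nu>.
  Higher modes are compared with powers of these quantities by induction, taking moduli in the
  source and thus discarding all oscillation.\<close>

lemma mode_supersolution:
  assumes a: "mode_system \<alpha> \<nu> A a" and "\<nu> > 0" "k \<ge> 1" "t \<ge> 0"
  defines "h \<equiv> \<lambda>t. sqrt (1 - exp (- (2 * \<nu> * t)))"
  shows "cmod (a k t) \<le> cmod A ^ k * exp (- (\<nu> * real k * t)) * (3 / \<nu>) ^ (k - 1) *
    (if k = 1 then 1 else h t ^ k)"
  using \<open>k \<ge> 1\<close> \<open>t \<ge> 0\<close>
proof (induction k arbitrary: t rule: less_induct)
  case (less k)
  define H where "H j t = (if j = 1 then 1 else h t ^ j)" for j :: nat and t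
  define r where "r = 3 / \<nu>"
  have h0: "h t \<ge> 0" if "t \<ge> 0" for t using that \<open>\<nu> > 0\<close> by (simp add: h_def)
  show ?case
  proof (cases "k = 1")
    case True
    then show ?thesis using first_mode[OF a \<open>t \<ge> 0\<close>] by (simp add: norm_mult)
  next
    case False
    with less.prems have k: "k \<ge> 2" by simp
    then obtain m where m: "k = Suc (Suc m)" by (metis Suc_le_D numeral_2_eq_2 Suc_le_mono)
    define l where "l = symb \<alpha> \<nu> k"
    define K where "K = (real k)\<^sup>2 - real k"
    have Rel: "Re l = - \<nu> * (real k)\<^sup>2" by (simp add: l_def symb_def)
    \<comment> \<open>The last factor anticipates the derivative of the comparison function \<phi>:
      multiplied by exp(\<nu> k^2 t), the right-hand side is exactly
      \<open>\<phi>' t\<close>.\<close>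
    have src: "cmod (mode_source a k t) \<le> cmod A ^ k * exp (- (\<nu> * real k * t)) * r ^ (k - 1) *
        (real k * \<nu> * (h t ^ (k - 2) * ((real k - 2) * (h t)\<^sup>2 + 1)))" if t: "t > 0" for t
    proof -
      define B where "B = cmod A ^ k * exp (- (\<nu> * real k * t)) * r ^ (k - 2)"
      have "cmod (mode_source a k t) \<le> 3 * real k * (\<Sum>j=1..<k. cmod (a j t) * cmod (a (k - j) t))"
        unfolding mode_source_def norm_mult
        by (auto intro!: mult_left_mono order_trans[OF norm_sum] sum_mono simp: norm_mult)
      also have "\<dots> \<le> 3 * real k * (\<Sum>j=1..<k. B * (H j t * H (k - j) t))"
      proof (intro mult_left_mono sum_mono)
        fix j assume j: "j \<in> {1..<k}"
        have "cmod (a j t) * cmod (a (k - j) t) \<le>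
            (cmod A ^ j * exp (- (\<nu> * real j * t)) * r ^ (j - 1) * H j t) *
            (cmod A ^ (k - j) * exp (- (\<nu> * real (k - j) * t)) * r ^ (k - j - 1) * H (k - j) t)"
          unfolding H_def r_def using less.IH[of j t] less.IH[of "k - j" t] j t h0[of t] \<open>\<nu> > 0\<close>
          by (intro mult_mono) auto
        also have "\<dots> = (cmod A ^ j * cmod A ^ (k - j)) * (exp (- (\<nu> * real j * t)) * exp (- (\<nu> * real (k - j) * t)))
            * (r ^ (j - 1) * r ^ (k - j - 1)) * (H j t * H (k - j) t)" by (simp only: ac_simps)
        also have "cmod A ^ j * cmod A ^ (k - j) = cmod A ^ k" using j by (simp add: power_add[symmetric])
        also have "exp (- (\<nu> * real j * t)) * exp (- (\<nu> * real (k - j) * t)) = exp (- (\<nu> * real k * t))"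
          using j by (simp add: exp_add[symmetric] of_nat_diff algebra_simps)
        also have "r ^ (j - 1) * r ^ (k - j - 1) = r ^ (k - 2)"
          using j by (auto simp: power_add[symmetric] intro!: arg_cong[where f="power r"])
        finally show "cmod (a j t) * cmod (a (k - j) t) \<le> B * (H j t * H (k - j) t)"
          unfolding B_def .
      qed auto
      also have "\<dots> = 3 * real k * (B * (\<Sum>j=1..<k. H j t * H (k - j) t))"
        by (simp add: sum_distrib_left)
      also have "\<dots> \<le> 3 * real k * (B * (h t ^ (k - 2) * ((real k - 2) * (h t)\<^sup>2 + 1)))"
      proof (intro mult_left_mono)
        show "(\<Sum>j=1..<k. H j t * H (k - j) t) \<le> h t ^ (k - 2) * ((real k - 2) * (h t)\<^sup>2 + 1)"
        proof (cases "k = 2")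
          case True
          then show ?thesis unfolding H_def convolution_geometric_except_first[OF k] by simp
        next
          case False
          have p: "h t ^ (k - 1) = h t ^ (k - 2) * h t" "h t ^ k = h t ^ (k - 2) * (h t)\<^sup>2"
            by (simp_all add: m power2_eq_square)
          \<comment> \<open>This is (h - 1)^2 \<ge> 0. For k = 2 no such loss occurs, as both sides
            are 1.\<close>
          have "2 * h t + (real k - 3) * (h t)\<^sup>2 \<le> (real k - 2) * (h t)\<^sup>2 + 1"
            using zero_le_power2[of "h t - 1"] by (simp add: power2_eq_square algebra_simps)
          from mult_left_mono[OF this, of "h t ^ (k - 2)"] show ?thesis
            using False h0[of t] t
            unfolding H_def convolution_geometric_except_first[OF k] p by (simp add: algebra_simps)
        qed
      qed (use \<open>\<nu> > 0\<close> in \<open>auto simp: B_def r_def\<close>)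
      \<comment> \<open>Writing 3 = (3/\<nu>) \<nu> raises r^(k-2) to the required r^(k-1); the two
        factors of the source carry only j - 1 and k - j - 1 powers of r.\<close>
      also have "\<dots> = (3 / \<nu>) * B * (real k * \<nu> * (h t ^ (k - 2) * ((real k - 2) * (h t)\<^sup>2 + 1)))"
        using \<open>\<nu> > 0\<close> by simp
      also have "(3 / \<nu>) * B = cmod A ^ k * exp (- (\<nu> * real k * t)) * r ^ (k - 1)"
        by (simp add: B_def r_def m)
      finally show ?thesis .
    qed
    define C where "C = cmod A ^ k * r ^ (k - 1)"
    \<comment> \<open>The integrating factor removes the linear term, and its modulus depends on the
      real part of \<open>l\<close> only, so \<alpha> drops out of the comparison.\<close>
    define w where "w t = exp (- l * of_real t) * a k t" for t
    define \<phi> where "\<phi> t = C * (exp (\<nu> * K * t) * h t ^ k)" for t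
    define \<phi>' where "\<phi>' t = C * (exp (\<nu> * K * t) * (real k * \<nu> * (h t ^ (k - 2) * ((real k - 2) * (h t)\<^sup>2 + 1))))" for t
    have wd: "(w has_vector_derivative exp (- l * of_real t) * mode_source a k t) (at t within {0..})"
      if "t \<ge> 0" for t
      unfolding w_def using mode_systemD(3)[OF a that, of k] l_def
      by (intro integrating_factor_has_vector_derivative) auto
    have w: "w 0 = 0" using mode_systemD(2)[OF a, of k] k by (simp add: w_def)
    have \<phi>0: "\<phi> 0 = 0" using k by (simp add: \<phi>_def h_def)
    have \<phi>: "(\<phi> has_vector_derivative \<phi>' t) (at t)" if "t > 0" for t
    proof -
      have e1: "exp (- (2 * \<nu> * t)) < 1" using that \<open>\<nu> > 0\<close> by simp
      have hp: "h t > 0" using e1 by (simp add: h_def)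
      have "(h has_real_derivative (\<nu> * exp (- (2 * \<nu> * t)) / h t)) (at t)"
        unfolding h_def using e1 by (auto intro!: derivative_eq_intros simp: field_simps)
      also have "exp (- (2 * \<nu> * t)) = 1 - (h t)\<^sup>2" using e1 by (simp add: h_def)
      finally have hd: "(h has_real_derivative (\<nu> * (1 - (h t)\<^sup>2) / h t)) (at t)" .
      have "(\<phi> has_real_derivative C * (exp (\<nu> * K * t) * (real k * h t ^ (k - 1) * (\<nu> * (1 - (h t)\<^sup>2) / h t))
          + \<nu> * K * exp (\<nu> * K * t) * h t ^ k)) (at t)"
        unfolding \<phi>_def by (auto intro!: derivative_eq_intros hd)
      \<comment> \<open>The exponential contributes (k^2 - k) h^k and the power of h contributes k
        h^(k-2) (1 - h^2); they add up to k h^(k-2) ((k - 2) h^2 + 1), each with the common factor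
        \<nu>.\<close>
      also have "C * (exp (\<nu> * K * t) * (real k * h t ^ (k - 1) * (\<nu> * (1 - (h t)\<^sup>2) / h t))
          + \<nu> * K * exp (\<nu> * K * t) * h t ^ k) = \<phi>' t"
        using hp unfolding \<phi>'_def K_def m by (simp add: field_simps power2_eq_square)
      finally show ?thesis by (simp add: has_real_derivative_iff_has_vector_derivative)
    qed
    \<comment> \<open>The slope of \<open>h\<close> is infinite at 0, so the mean value estimate
      uses derivatives in the open interval and mere continuity at its ends. Both functions vanish
      at 0.\<close>
    have "norm (w t - w 0) \<le> \<phi> t - \<phi> 0" if t: "0 < t"
    proof (rule differentiable_bound_general[OF t])
      show "continuous_on {0..t} w"
      proof (rule continuous_on_vector_derivative)
        fix x assume "x \<in> {0..t}"
        then show "(w has_vector_derivative exp (- l * of_real x) * mode_source a k x) (at x within {0..t})"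
          using wd[of x] by (auto intro: has_vector_derivative_within_subset)
      qed
      show "continuous_on {0..t} \<phi>" unfolding \<phi>_def h_def by (intro continuous_intros)
      fix x assume x: "0 < x" "x < t"
      show "(w has_vector_derivative exp (- l * of_real x) * mode_source a k x) (at x)"
        using wd[of x] x at_within_interior[of x "{0..}"] by simp
      show "(\<phi> has_vector_derivative \<phi>' x) (at x)" using \<phi> x by simp
      have "\<nu> * K * x = \<nu> * (real k)\<^sup>2 * x + - (\<nu> * real k * x)"
        by (simp add: K_def algebra_simps)
      then have "exp (\<nu> * K * x) = exp (\<nu> * (real k)\<^sup>2 * x) * exp (- (\<nu> * real k * x))"
        by (simp only: exp_add)
      then show "norm (exp (- l * of_real x) * mode_source a k x) \<le> \<phi>' x"
        using mult_left_mono[OF src[OF x(1)], of "exp (\<nu> * (real k)\<^sup>2 * x)"]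
        by (simp add: norm_mult Rel \<phi>'_def C_def ac_simps)
    qed
    then have "cmod (w t) \<le> \<phi> t" using w \<phi>0 \<open>t \<ge> 0\<close> by (cases "t = 0") auto
    moreover have "a k t = exp (l * of_real t) * w t"
      by (simp add: w_def mult.assoc[symmetric] exp_add[symmetric])
    ultimately have "cmod (a k t) \<le> exp (- (\<nu> * (real k)\<^sup>2 * t)) * \<phi> t"
      by (simp add: norm_mult Rel)
    also have "\<dots> = C * ((exp (- (\<nu> * (real k)\<^sup>2 * t)) * exp (\<nu> * K * t)) * h t ^ k)"
      by (simp add: \<phi>_def)
    also have "exp (- (\<nu> * (real k)\<^sup>2 * t)) * exp (\<nu> * K * t) = exp (- (\<nu> * real k * t))"
      unfolding exp_add[symmetric] by (simp add: K_def algebra_simps)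
    finally show ?thesis using False by (simp add: C_def r_def ac_simps)
  qed
qed

text \<open>For k \<ge> 2 the supersolution is \<nu>/3 times the k-th power of 3 |A| y h / \<nu>,
  where y = exp (- \<nu> t), and the smallness hypothesis says 3 y h \<le> \<nu>.\<close>

lemma mode_bound_dissipative:
  assumes a: "mode_system \<alpha> \<nu> A a" and "\<nu> > 0" "k \<ge> 1" "t \<ge> 0"
    and small: "exp (- (2 * \<nu> * t)) * (1 - exp (- (2 * \<nu> * t))) \<le> \<nu>\<^sup>2 / 9"
  shows "cmod (a k t) \<le> (1 + \<nu> / 3) * real k * cmod A ^ k"
proof -
  define y where "y = exp (- (\<nu> * t))"
  define h where "h = sqrt (1 - exp (- (2 * \<nu> * t)))"
  have y2: "y\<^sup>2 = exp (- (2 * \<nu> * t))"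
    unfolding y_def exp_double[symmetric] by (simp add: mult.assoc)
  have y: "0 < y" "y \<le> 1" using assms by (auto simp: y_def)
  have h: "h \<ge> 0" "h\<^sup>2 = 1 - exp (- (2 * \<nu> * t))" using assms by (auto simp: h_def)
  have "(3 * y * h)\<^sup>2 \<le> \<nu>\<^sup>2"
    using small h(2) y2 by (simp add: power_mult_distrib)
  then have yh: "3 / \<nu> * y * h \<le> 1"
    using power2_le_imp_le[of "3 * y * h" \<nu>] \<open>\<nu> > 0\<close> by (simp add: field_simps)
  have e: "exp (- (\<nu> * real k * t)) = y ^ k"
    unfolding y_def exp_of_nat_mult[symmetric] by (simp add: ac_simps)
  have "cmod (a k t) \<le> cmod A ^ k * y ^ k * (3 / \<nu>) ^ (k - 1) * (if k = 1 then 1 else h ^ k)"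
    using mode_supersolution[OF a \<open>\<nu> > 0\<close> \<open>k \<ge> 1\<close> \<open>t \<ge> 0\<close>] unfolding e h_def .
  also have "\<dots> \<le> (1 + \<nu> / 3) * real k * cmod A ^ k"
  proof (cases "k = 1")
    case True
    have "cmod A * y \<le> cmod A * 1" using y by (intro mult_left_mono) auto
    also have "\<dots> \<le> (1 + \<nu> / 3) * cmod A" using \<open>\<nu> > 0\<close> by (simp add: algebra_simps)
    finally show ?thesis using True by simp
  next
    case False
    have "(3 / \<nu>) ^ (k - 1) = \<nu> / 3 * (3 / \<nu>) ^ k"
      using \<open>k \<ge> 1\<close> \<open>\<nu> > 0\<close> by (cases k) auto
    then have "cmod A ^ k * y ^ k * (3 / \<nu>) ^ (k - 1) * (if k = 1 then 1 else h ^ k) =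
        cmod A ^ k * y ^ k * (\<nu> / 3 * (3 / \<nu>) ^ k) * h ^ k"
      using False by simp
    also have "\<dots> = \<nu> / 3 * cmod A ^ k * (3 / \<nu> * y * h) ^ k"
      unfolding power_mult_distrib by (simp only: ac_simps)
    also have "\<dots> \<le> \<nu> / 3 * cmod A ^ k * 1"
      using yh y h \<open>\<nu> > 0\<close> by (intro mult_left_mono power_le_one) auto
    also have "\<dots> \<le> (1 + \<nu> / 3) * real k * cmod A ^ k"
    proof -
      have "\<nu> / 3 * 1 \<le> (1 + \<nu> / 3) * real k"
        using \<open>k \<ge> 1\<close> \<open>\<nu> > 0\<close> by (intro mult_mono) auto
      from mult_right_mono[OF this, of "cmod A ^ k"] show ?thesis by simp
    qed
    finally show ?thesis .
  qed
  finally show ?thesis .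
qed

lemma mode_bound:
  assumes a: "mode_system \<alpha> \<nu> A a" and nonneg: "\<nu> \<ge> 0" "\<alpha> \<ge> 0" and cond: "\<nu>\<^sup>2 + 4 * \<alpha>\<^sup>2 \<ge> 9"
    and "t \<ge> 0"
  shows "cmod (a k t) \<le> (1 + \<alpha> / 2 + \<nu> / 3) * real k * cmod A ^ k"
proof (cases "k = 0")
  case True
  then show ?thesis using mode_systemD(1)[OF a] by simp
next
  case False
  then have k: "k \<ge> 1" by simp
  define Y where "Y = exp (- (2 * \<nu> * t))"
  have Y: "0 < Y" "Y \<le> 1" using nonneg \<open>t \<ge> 0\<close> by (auto simp: Y_def)
  have mono: "c * real k * cmod A ^ k \<le> (1 + \<alpha> / 2 + \<nu> / 3) * real k * cmod A ^ k"
    if "c \<le> 1 + \<alpha> / 2 + \<nu> / 3" for c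
    using that by (intro mult_right_mono) auto
  show ?thesis
  proof (cases "2 * Y \<le> \<alpha>\<^sup>2")
    case True
    then have "\<alpha> > 0" using Y nonneg by (cases "\<alpha> = 0") auto
    from mode_bound_dispersive[OF a this nonneg(1) k \<open>t \<ge> 0\<close>] True show ?thesis
      unfolding Y_def using mono[of "1 + \<alpha> / 2"] nonneg by (auto intro: order_trans)
  next
    case False
    with cond have low: "9 - \<nu>\<^sup>2 < 8 * Y" by simp
    \<comment> \<open>For \<nu> = 0 the inequality just obtained would say 9 < 8 Y, against Y \<le>
      1.\<close>
    then have "\<nu> > 0" using Y nonneg by (cases "\<nu> = 0") auto
    have "Y * (1 - Y) \<le> \<nu>\<^sup>2 / 9"
    proof (cases "\<nu>\<^sup>2 \<ge> 9 / 4")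
      case True
      have "Y * (1 - Y) \<le> 1 / 4" using zero_le_power2[of "Y - 1/2"] by (simp add: power2_eq_square algebra_simps)
      then show ?thesis using True by simp
    next
      case False
      define n where "n = \<nu>\<^sup>2"
      have "(1 - Y) \<le> (n - 1) / 8" using low n_def by simp
      moreover have "Y * (1 - Y) \<le> 1 - Y" using Y by (simp add: mult_left_le_one_le)
      moreover have "(n - 1) / 8 \<le> n / 9" using False n_def by simp
      ultimately show ?thesis unfolding n_def by linarith
    qed
    from mode_bound_dissipative[OF a \<open>\<nu> > 0\<close> k \<open>t \<ge> 0\<close>] this show ?thesis
      unfolding Y_def using mono[of "1 + \<nu> / 3"] nonneg by (auto intro: order_trans)
  qed
qed

section \<open>Uniqueness\<close>

text \<open>Rescaling to the unit interval moves the variable endpoint into the integrand, where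
  continuity of parameter integrals over a fixed interval applies.\<close>

lemma integral_upto_continuous_on:
  fixes f :: "real \<Rightarrow> real \<Rightarrow> 'a::banach"
  assumes f: "continuous_on ({0..b} \<times> T) (\<lambda>p. f (fst p) (snd p))"
  shows "continuous_on ({0..b} \<times> T) (\<lambda>p. integral {0..fst p} (\<lambda>y. f y (snd p)))"
proof -
  have eq: "integral {0..x} g = x *\<^sub>R integral {0..1} (\<lambda>s. g (x * s))" if "x \<ge> 0"
    for x and g :: "real \<Rightarrow> 'a"
  proof (cases "x = 0")
    case False
    then have "(\<lambda>y. y / x) ` {0..x} = {0..1}"
      using that by (simp add: image_divide_atLeastAtMost)
    then show ?thesis
      using integral_stretch_real[of x 0 x g] False that by simp
  qed simp
  have "continuous_on (({0..b} \<times> T) \<times> cbox 0 1) (\<lambda>z. f (fst (fst z) * snd z) (snd (fst z)))"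
    by (rule continuous_on_compose2[OF f, where f="\<lambda>z. (fst (fst z) * snd z, snd (fst z))", simplified])
      (auto intro!: continuous_intros mult_left_le order_trans[OF mult_left_le])
  then have "continuous_on ({0..b} \<times> T) (\<lambda>p. integral (cbox 0 1) (\<lambda>s. f (fst p * s) (snd p)))"
    by (intro integral_continuous_on_param) (simp add: split_beta)
  then have "continuous_on ({0..b} \<times> T) (\<lambda>p. fst p *\<^sub>R integral {0..1} (\<lambda>s. f (fst p * s) (snd p)))"
    by (intro continuous_intros) auto
  then show ?thesis by (rule continuous_on_eq) (rule eq[symmetric], auto)
qed

lemma continuous_on_slices:
  assumes "continuous_on (A \<times> B) (\<lambda>p. f (fst p) (snd p))"
  shows "t \<in> B \<Longrightarrow> S \<subseteq> A \<Longrightarrow> continuous_on S (\<lambda>x. f x t)"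
    and "x \<in> A \<Longrightarrow> S \<subseteq> B \<Longrightarrow> continuous_on S (\<lambda>t. f x t)"
proof -
  assume *: "t \<in> B" "S \<subseteq> A"
  have "continuous_on S (\<lambda>x. f (fst (x, t)) (snd (x, t)))"
    by (rule continuous_on_compose2[OF assms]) (use * in \<open>auto intro!: continuous_intros\<close>)
  then show "continuous_on S (\<lambda>x. f x t)" by simp
next
  assume *: "x \<in> A" "S \<subseteq> B"
  have "continuous_on S (\<lambda>t. f (fst (x, t)) (snd (x, t)))"
    by (rule continuous_on_compose2[OF assms]) (use * in \<open>auto intro!: continuous_intros\<close>)
  then show "continuous_on S (\<lambda>t. f x t)" by simp
qed

lemma periodic_imp_vector_derivative_periodic:
  assumes "\<And>x. f (x + c) = f x" "\<And>x. (f has_vector_derivative f' x) (at x)"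
  shows "f' (x + c) = f' x"
proof -
  have "((\<lambda>y. y + c) has_vector_derivative 1) (at x)" by (auto intro!: derivative_eq_intros)
  from vector_diff_chain_at[OF this assms(2)]
  have "(f has_vector_derivative f' (x + c)) (at x)" by (simp add: o_def assms(1))
  then show ?thesis using assms(2) vector_derivative_unique_at by blast
qed

text \<open>Integration over a period removes the flux, so e^(-Kt) times the integral of
  \<open>q\<close> is nonincreasing and starts from zero; a continuous nonnegative function with
  zero integral vanishes. The derivative hypotheses stop short of t = 0 because the equation is
  assumed for t > 0 only.\<close>

lemma conservation_gronwall:
  fixes q q' \<Phi> \<Phi>' :: "real \<Rightarrow> real \<Rightarrow> real"
  assumes ab: "a < b"
    and q0: "\<And>x. x \<in> {a..b} \<Longrightarrow> q x 0 = 0"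
    and nonneg: "\<And>x t. x \<in> {a..b} \<Longrightarrow> 0 \<le> t \<Longrightarrow> t \<le> T \<Longrightarrow> q x t \<ge> 0"
    and q: "continuous_on ({a..b} \<times> {0..T}) (\<lambda>p. q (fst p) (snd p))"
    and q': "continuous_on ({a..b} \<times> {0<..<T}) (\<lambda>p. q' (fst p) (snd p))"
    and dq: "\<And>x t. x \<in> {a..b} \<Longrightarrow> 0 < t \<Longrightarrow> t < T \<Longrightarrow>
      ((\<lambda>s. q x s) has_vector_derivative q' x t) (at t)"
    and d\<Phi>: "\<And>x t. x \<in> {a..b} \<Longrightarrow> 0 < t \<Longrightarrow> t < T \<Longrightarrow>
      ((\<lambda>y. \<Phi> y t) has_vector_derivative \<Phi>' x t) (at x within {a..b})"
    and per: "\<And>t. 0 < t \<Longrightarrow> t < T \<Longrightarrow> \<Phi> b t = \<Phi> a t"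
    and le: "\<And>x t. x \<in> {a..b} \<Longrightarrow> 0 < t \<Longrightarrow> t < T \<Longrightarrow> q' x t \<le> \<Phi>' x t + K * q x t"
    and x: "x \<in> {a..b}" and t: "0 \<le> t" "t \<le> T"
  shows "q x t = 0"
proof -
  define E where "E t = integral {a..b} (\<lambda>x. q x t)" for t
  have swap: "continuous_on (I \<times> cbox a b) (\<lambda>(t, x). f x t)"
    if "continuous_on ({a..b} \<times> I) (\<lambda>p. f (fst p) (snd p))"
    for I and f :: "real \<Rightarrow> real \<Rightarrow> real"
  proof -
    have "continuous_on (I \<times> cbox a b) (\<lambda>z. f (fst (prod.swap z)) (snd (prod.swap z)))"
      by (rule continuous_on_compose2[OF that continuous_on_swap]) auto
    then show ?thesis by (simp add: split_beta)
  qed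
  note slice = continuous_on_slices(1)[OF _ _ order_refl]
  have contE: "continuous_on {0..T} E"
    unfolding E_def using integral_continuous_on_param[OF swap[OF q]] by simp
  have dE: "(E has_vector_derivative integral {a..b} (\<lambda>x. q' x t)) (at t)" if "0 < t" "t < T" for t
  proof -
    have "((\<lambda>t. integral (cbox a b) (\<lambda>x. q x t)) has_vector_derivative
        integral (cbox a b) (\<lambda>x. q' x t)) (at t within {0<..<T})"
    proof (rule leibniz_rule_vector_derivative[OF _ _ swap[OF q']])
      show "(\<lambda>x. q x s) integrable_on cbox a b" if "s \<in> {0<..<T}" for s
        using slice[OF q, of s] that integrable_continuous_real by auto
    qed (use dq that in \<open>auto intro: has_vector_derivative_at_within\<close>)
    then show ?thesis using that at_within_open[of t "{0<..<T}"] by (simp add: E_def[abs_def])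
  qed
  have E': "integral {a..b} (\<lambda>x. q' x t) \<le> K * E t" if "0 < t" "t < T" for t
  proof -
    have "((\<lambda>x. \<Phi>' x t) has_integral (\<Phi> b t - \<Phi> a t)) {a..b}"
      using ab d\<Phi> that by (intro fundamental_theorem_of_calculus) auto
    then have "((\<lambda>x. \<Phi>' x t) has_integral 0) {a..b}" using per that by simp
    moreover have "((\<lambda>x. K * q x t) has_integral K * E t) {a..b}"
      unfolding E_def using slice[OF q, of t] that
      by (intro has_integral_mult_right integrable_integral integrable_continuous_real) auto
    ultimately have rhs: "((\<lambda>x. \<Phi>' x t + K * q x t) has_integral 0 + K * E t) {a..b}"
      by (rule has_integral_add)
    have "((\<lambda>x. q' x t) has_integral integral {a..b} (\<lambda>x. q' x t)) {a..b}"
      using slice[OF q', of t] that by (intro integrable_integral integrable_continuous_real) auto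
    from has_integral_le[OF this rhs] le that
    have "integral {a..b} (\<lambda>x. q' x t) \<le> 0 + K * E t" by simp
    then show ?thesis by simp
  qed
  have "E 0 = 0" using integral_cong[of "{a..b}" "\<lambda>x. q x 0" "\<lambda>_. 0"] q0 by (simp add: E_def)
  have "exp (- K * t) * E t \<le> exp (- K * 0) * E 0"
  proof (rule DERIV_nonpos_imp_decreasing_open[where f="\<lambda>t. exp (- K * t) * E t", OF t(1)])
    fix s assume s: "0 < s" "s < t"
    let ?d = "integral {a..b} (\<lambda>x. q' x s)"
    have "(E has_real_derivative ?d) (at s)"
      using dE s t by (simp add: has_real_derivative_iff_has_vector_derivative)
    then have "((\<lambda>t. exp (- K * t) * E t) has_real_derivative
        exp (- K * s) * (- K) * E s + ?d * exp (- K * s)) (at s)"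
      by (intro DERIV_mult DERIV_fun_exp) (auto intro!: derivative_eq_intros)
    then have "((\<lambda>t. exp (- K * t) * E t) has_real_derivative exp (- K * s) * (?d - K * E s)) (at s)"
      by (simp add: algebra_simps)
    moreover have "exp (- K * s) * (?d - K * E s) \<le> 0"
      using E'[of s] s t by (intro mult_nonneg_nonpos) auto
    ultimately show "\<exists>y. ((\<lambda>t. exp (- K * t) * E t) has_real_derivative y) (at s) \<and> y \<le> 0" by blast
  next
    show "continuous_on {0..t} (\<lambda>t. exp (- K * t) * E t)"
      using continuous_on_subset[OF contE] t by (intro continuous_intros) auto
  qed
  then have "E t \<le> 0" using \<open>E 0 = 0\<close> by (simp add: mult_le_0_iff)
  moreover have "E t \<ge> 0" unfolding E_def using nonneg t slice[OF q, of t]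
    by (intro integral_nonneg integrable_continuous_real) auto
  ultimately have "E t = 0" by simp
  then show ?thesis
    using integral_eq_0_iff[of a b "\<lambda>x. q x t"] slice[OF q, of t] ab nonneg t x
    unfolding E_def by auto
qed

section \<open>Energy estimates for antiderivatives of solutions\<close>

lemma inner_has_vector_derivative:
  assumes "(f has_vector_derivative f') (at x within S)" "(g has_vector_derivative g') (at x within S)"
  shows "((\<lambda>x. f x \<bullet> g x) has_vector_derivative f x \<bullet> g' + f' \<bullet> g x) (at x within S)"
  using assms by (rule bounded_bilinear.has_vector_derivative[OF bounded_bilinear_inner])

text \<open>Integration by parts in pointwise form, for f_t = \<nu> f_xx - \<alpha> f_xxx:
  dispersion contributes a pure flux, viscosity a flux and the dissipation 2 \<nu> |f_x|^2, which is
  available to absorb other terms.\<close>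

lemma energy_flux_has_vector_derivative:
  fixes f f1 f2 :: "real \<Rightarrow> 'a::real_inner"
  assumes f: "(f has_vector_derivative f1 x) (at x within S)"
    and f1: "(f1 has_vector_derivative f2 x) (at x within S)"
    and f2: "(f2 has_vector_derivative f3) (at x within S)"
  shows "((\<lambda>y. - 2 * \<alpha> * (f y \<bullet> f2 y) + \<alpha> * (f1 y \<bullet> f1 y) + 2 * \<nu> * (f y \<bullet> f1 y)) has_vector_derivative
    2 * (f x \<bullet> (\<nu> *\<^sub>R f2 x - \<alpha> *\<^sub>R f3)) + 2 * \<nu> * (f1 x \<bullet> f1 x)) (at x within S)"
proof -
  have "((\<lambda>y. - 2 * \<alpha> * (f y \<bullet> f2 y) + \<alpha> * (f1 y \<bullet> f1 y) + 2 * \<nu> * (f y \<bullet> f1 y)) has_vector_derivative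
    - 2 * \<alpha> * (f x \<bullet> f3 + f1 x \<bullet> f2 x) + \<alpha> * (f1 x \<bullet> f2 x + f2 x \<bullet> f1 x) + 2 * \<nu> * (f x \<bullet> f2 x + f1 x \<bullet> f1 x))
    (at x within S)"
    by (intro has_vector_derivative_add has_vector_derivative_mult_right inner_has_vector_derivative assms)
  moreover have "- 2 * \<alpha> * (f x \<bullet> f3 + f1 x \<bullet> f2 x) + \<alpha> * (f1 x \<bullet> f2 x + f2 x \<bullet> f1 x) + 2 * \<nu> * (f x \<bullet> f2 x + f1 x \<bullet> f1 x)
     = 2 * (f x \<bullet> (\<nu> *\<^sub>R f2 x - \<alpha> *\<^sub>R f3)) + 2 * \<nu> * (f1 x \<bullet> f1 x)"
    by (simp add: inner_diff_right inner_commute[of "f2 x" "f1 x"] algebra_simps)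
  ultimately show ?thesis by simp
qed

text \<open>The first clause of \<open>dt\<close> is the equation integrated once in x, with the
  integration constant normalised away. Everything lives on one closed period, with one-sided
  x-derivatives at its ends; periodicity survives as equality of end values, which is what cancels
  the fluxes.\<close>

locale kdvb_potential =
  fixes \<alpha> \<nu> :: real and U u u1 u2 u3 :: "real \<Rightarrow> real \<Rightarrow> complex"
  assumes cont:
      "continuous_on ({0..2*pi} \<times> {0..}) (\<lambda>p. U (fst p) (snd p))"
      "continuous_on ({0..2*pi} \<times> {0..}) (\<lambda>p. u (fst p) (snd p))"
      "continuous_on ({0..2*pi} \<times> {0..}) (\<lambda>p. u1 (fst p) (snd p))"
      "continuous_on ({0..2*pi} \<times> {0..}) (\<lambda>p. u2 (fst p) (snd p))"
      "continuous_on ({0..2*pi} \<times> {0..}) (\<lambda>p. u3 (fst p) (snd p))"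
    and dx:
      "\<And>x t. x \<in> {0..2*pi} \<Longrightarrow> t \<ge> 0 \<Longrightarrow> ((\<lambda>y. U y t) has_vector_derivative u x t) (at x within {0..2*pi})"
      "\<And>x t. x \<in> {0..2*pi} \<Longrightarrow> t \<ge> 0 \<Longrightarrow> ((\<lambda>y. u y t) has_vector_derivative u1 x t) (at x within {0..2*pi})"
      "\<And>x t. x \<in> {0..2*pi} \<Longrightarrow> t \<ge> 0 \<Longrightarrow> ((\<lambda>y. u1 y t) has_vector_derivative u2 x t) (at x within {0..2*pi})"
      "\<And>x t. x \<in> {0..2*pi} \<Longrightarrow> t \<ge> 0 \<Longrightarrow> ((\<lambda>y. u2 y t) has_vector_derivative u3 x t) (at x within {0..2*pi})"
    and dt:
      "\<And>x t. x \<in> {0..2*pi} \<Longrightarrow> t > 0 \<Longrightarrow> ((\<lambda>s. U x s) has_vector_derivative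
         3 * (u x t)\<^sup>2 - of_real \<alpha> * u2 x t + of_real \<nu> * u1 x t) (at t)"
      "\<And>x t. x \<in> {0..2*pi} \<Longrightarrow> t > 0 \<Longrightarrow> ((\<lambda>s. u x s) has_vector_derivative
         6 * u x t * u1 x t - of_real \<alpha> * u3 x t + of_real \<nu> * u2 x t) (at t)"
    and periodic:
      "\<And>t. t \<ge> 0 \<Longrightarrow> U (2*pi) t = U 0 t" "\<And>t. t \<ge> 0 \<Longrightarrow> u (2*pi) t = u 0 t"
      "\<And>t. t \<ge> 0 \<Longrightarrow> u1 (2*pi) t = u1 0 t" "\<And>t. t \<ge> 0 \<Longrightarrow> u2 (2*pi) t = u2 0 t"

lemma continuous_on_bounded_strip:
  fixes f :: "real \<Rightarrow> real \<Rightarrow> complex"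
  assumes "continuous_on ({0..b} \<times> {0..}) (\<lambda>p. f (fst p) (snd p))"
  obtains B where "B \<ge> 0" "\<And>x t. x \<in> {0..b} \<Longrightarrow> 0 \<le> t \<Longrightarrow> t \<le> T \<Longrightarrow> cmod (f x t) \<le> B"
proof -
  have "compact ((\<lambda>p. f (fst p) (snd p)) ` ({0..b} \<times> {0..T}))"
    by (intro compact_continuous_image continuous_on_subset[OF assms] compact_Times) auto
  then obtain B where B: "\<forall>z\<in>(\<lambda>p. f (fst p) (snd p)) ` ({0..b} \<times> {0..T}). cmod z \<le> B"
    using compact_imp_bounded bounded_iff by blast
  show ?thesis by (rule that[of "max B 0"]) (use B in \<open>force simp: le_max_iff_disj\<close>)+
qed

text \<open>Since v^2 - u^2 = (u + v)(v - u), the difference P satisfies P_t = 3 (u + v) P_x + \<nu>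
  P_xx - \<alpha> P_xxx. The first-order term is absorbed by the dissipation.\<close>

lemma potential_unique_viscous:
  assumes A: "kdvb_potential \<alpha> \<nu> U u u1 u2 u3" and B: "kdvb_potential \<alpha> \<nu> V v v1 v2 v3"
    and "\<nu> > 0" and init: "\<And>x. x \<in> {0..2*pi} \<Longrightarrow> V x 0 = U x 0"
    and x: "x \<in> {0..2*pi}" "t \<ge> 0"
  shows "V x t = U x t"
proof -
  interpret A: kdvb_potential \<alpha> \<nu> U u u1 u2 u3 by fact
  interpret B: kdvb_potential \<alpha> \<nu> V v v1 v2 v3 by fact
  let ?X = "{0..2*pi}" and ?T = "t + 1"
  define P where "P x t = V x t - U x t" for x t
  define w where "w x t = v x t - u x t" for x t
  define w1 where "w1 x t = v1 x t - u1 x t" for x t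
  define w2 where "w2 x t = v2 x t - u2 x t" for x t
  define g where "g x t = u x t + v x t" for x t
  note defs = P_def w_def w1_def w2_def g_def
  have cont: "continuous_on (?X \<times> {0..}) (\<lambda>p. g (fst p) (snd p))"
    "continuous_on (?X \<times> {0..}) (\<lambda>p. P (fst p) (snd p))"
    "continuous_on (?X \<times> {0..}) (\<lambda>p. w (fst p) (snd p))"
    "continuous_on (?X \<times> {0..}) (\<lambda>p. w1 (fst p) (snd p))"
    "continuous_on (?X \<times> {0..}) (\<lambda>p. w2 (fst p) (snd p))"
    unfolding defs by (intro continuous_intros A.cont B.cont)+
  obtain C where C: "C \<ge> 0" "\<And>x s. x \<in> ?X \<Longrightarrow> 0 \<le> s \<Longrightarrow> s \<le> ?T \<Longrightarrow> cmod (g x s) \<le> C"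
    using continuous_on_bounded_strip[OF cont(1)] by blast
  \<comment> \<open>The constant that completes the square in 6 C p y \<le> 2 \<nu> y^2 + K
    p^2.\<close>
  define K where "K = 9 * C\<^sup>2 / (2 * \<nu>)"
  define Pt where "Pt x t = 3 * g x t * w x t - of_real \<alpha> * w2 x t + of_real \<nu> * w1 x t" for x t
  have "P x t \<bullet> P x t = 0"
  proof (rule conservation_gronwall[where q="\<lambda>x t. P x t \<bullet> P x t" and q'="\<lambda>x t. 2 * (P x t \<bullet> Pt x t)" and T="?T" and K=K
        and \<Phi>="\<lambda>x t. - 2 * \<alpha> * (P x t \<bullet> w1 x t) + \<alpha> * (w x t \<bullet> w x t) + 2 * \<nu> * (P x t \<bullet> w x t)"
        and \<Phi>'="\<lambda>x t. 2 * (P x t \<bullet> (\<nu> *\<^sub>R w1 x t - \<alpha> *\<^sub>R w2 x t)) + 2 * \<nu> * (w x t \<bullet> w x t)", OF _ _ _ _ _ _ _ _ _ x(1) x(2)])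
    show "P x 0 \<bullet> P x 0 = 0" if "x \<in> ?X" for x using init that by (simp add: P_def)
    show "continuous_on (?X \<times> {0..?T}) (\<lambda>p. P (fst p) (snd p) \<bullet> P (fst p) (snd p))"
      by (intro continuous_intros continuous_on_subset[OF cont(2)]) auto
    show "continuous_on (?X \<times> {0<..<?T}) (\<lambda>p. 2 * (P (fst p) (snd p) \<bullet> Pt (fst p) (snd p)))"
      unfolding Pt_def by (intro continuous_intros cont[THEN continuous_on_subset]) auto
    fix x s assume x: "x \<in> ?X" and s: "0 < s" "s < ?T"
    have "((\<lambda>s. P x s) has_vector_derivative Pt x s) (at s)"
    proof -
      have "((\<lambda>s. P x s) has_vector_derivative
         (3 * (v x s)\<^sup>2 - of_real \<alpha> * v2 x s + of_real \<nu> * v1 x s) -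
         (3 * (u x s)\<^sup>2 - of_real \<alpha> * u2 x s + of_real \<nu> * u1 x s)) (at s)"
        unfolding P_def by (intro has_vector_derivative_diff A.dt B.dt x s)
      then show ?thesis by (simp add: Pt_def defs algebra_simps power2_eq_square)
    qed
    from inner_has_vector_derivative[OF this this]
    show "((\<lambda>s. P x s \<bullet> P x s) has_vector_derivative 2 * (P x s \<bullet> Pt x s)) (at s)"
      by (simp add: inner_commute)
    show "((\<lambda>y. - 2 * \<alpha> * (P y s \<bullet> w1 y s) + \<alpha> * (w y s \<bullet> w y s) + 2 * \<nu> * (P y s \<bullet> w y s)) has_vector_derivative
       2 * (P x s \<bullet> (\<nu> *\<^sub>R w1 x s - \<alpha> *\<^sub>R w2 x s)) + 2 * \<nu> * (w x s \<bullet> w x s)) (at x within ?X)"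
    proof (rule energy_flux_has_vector_derivative)
      show "((\<lambda>y. P y s) has_vector_derivative w x s) (at x within ?X)"
        "((\<lambda>y. w y s) has_vector_derivative w1 x s) (at x within ?X)"
        "((\<lambda>y. w1 y s) has_vector_derivative w2 x s) (at x within ?X)"
        unfolding defs using x s by (intro has_vector_derivative_diff A.dx B.dx; simp)+
    qed
    have "2 * (P x s \<bullet> Pt x s) = 2 * (P x s \<bullet> (\<nu> *\<^sub>R w1 x s - \<alpha> *\<^sub>R w2 x s)) + 2 * (P x s \<bullet> (3 * g x s * w x s))"
      unfolding Pt_def scaleR_conv_of_real by (simp add: inner_add_right inner_diff_right algebra_simps)
    also have "2 * (P x s \<bullet> (3 * g x s * w x s)) \<le> 2 * \<nu> * (w x s \<bullet> w x s) + K * (P x s \<bullet> P x s)"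
    proof -
      define p y where "p = cmod (P x s)" and "y = cmod (w x s)"
      have "P x s \<bullet> (3 * g x s * w x s) \<le> cmod (P x s) * (3 * cmod (g x s) * cmod (w x s))"
        using norm_cauchy_schwarz[of "P x s" "3 * g x s * w x s"] by (simp add: norm_mult)
      also have "\<dots> \<le> cmod (P x s) * (3 * C * cmod (w x s))"
        using C x s by (intro mult_left_mono mult_right_mono) auto
      also have "\<dots> = 3 * C * p * y" by (simp add: p_def y_def)
      finally have "2 * (P x s \<bullet> (3 * g x s * w x s)) \<le> 6 * C * p * y" by simp
      also have "\<dots> \<le> 2 * \<nu> * y\<^sup>2 + K * p\<^sup>2"
      proof -
        have "0 \<le> (2 * \<nu> * y - 3 * C * p)\<^sup>2 / (2 * \<nu>)" using \<open>\<nu> > 0\<close> by simp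
        also have "\<dots> = 2 * \<nu> * y\<^sup>2 + K * p\<^sup>2 - 6 * C * p * y"
          using \<open>\<nu> > 0\<close> by (simp add: K_def power2_eq_square field_simps)
        finally show ?thesis by simp
      qed
      finally show ?thesis by (simp add: p_def y_def power2_norm_eq_inner)
    qed
    finally show "2 * (P x s \<bullet> Pt x s) \<le> 2 * (P x s \<bullet> (\<nu> *\<^sub>R w1 x s - \<alpha> *\<^sub>R w2 x s)) + 2 * \<nu> * (w x s \<bullet> w x s)
       + K * (P x s \<bullet> P x s)" by simp
  qed (auto simp: defs A.periodic B.periodic)
  then show ?thesis by (simp add: P_def)
qed

text \<open>Without viscosity the term \<open>3 i (Im g) w\<^sub>x\<close> with \<open>w = v - u\<close>, \<open>g = u + v\<close> loses one
  derivative. Since \<open>\<alpha> \<partial>\<^sup>3 (G \<partial>\<^sup>-\<^sup>1 w) \<approx> \<alpha> G \<partial>\<^sup>2 w + 3 \<alpha> g w\<^sub>x\<close> for \<open>G\<^sub>x = g\<close>, the gauge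
  \<open>z = w - G P / \<alpha>\<close> with \<open>P\<^sub>x = w\<close> removes it, and the pair \<open>(P, z)\<close> obeys an energy estimate.\<close>

lemma potential_unique_inviscid:
  assumes A: "kdvb_potential \<alpha> 0 U u u1 u2 u3" and B: "kdvb_potential \<alpha> 0 V v v1 v2 v3"
    and "\<alpha> \<noteq> 0" and init: "\<And>x. x \<in> {0..2*pi} \<Longrightarrow> V x 0 = U x 0"
      "\<And>x. x \<in> {0..2*pi} \<Longrightarrow> v x 0 = u x 0"
    and x: "x \<in> {0..2*pi}" "t \<ge> 0"
  shows "V x t = U x t"
proof -
  interpret A: kdvb_potential \<alpha> 0 U u u1 u2 u3 by fact
  interpret B: kdvb_potential \<alpha> 0 V v v1 v2 v3 by fact
  let ?X = "{0..2*pi}" and ?T = "t + 1"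
  \<comment> \<open>With \<alpha> c = -1 the terms of \<open>zt\<close> that contain a derivative of
    \<open>w\<close> cancel, except for those inside -\<alpha> \<open>z3\<close>.\<close>
  define c where "c = complex_of_real (- 1 / \<alpha>)"
  have ca: "of_real \<alpha> * c = -1" using \<open>\<alpha> \<noteq> 0\<close> by (simp add: c_def)
  define P where "P x t = V x t - U x t" for x t
  define w where "w x t = v x t - u x t" for x t
  define w1 where "w1 x t = v1 x t - u1 x t" for x t
  define w2 where "w2 x t = v2 x t - u2 x t" for x t
  define w3 where "w3 x t = v3 x t - u3 x t" for x t
  define G where "G x t = U x t + V x t" for x t
  define g where "g x t = u x t + v x t" for x t
  define g1 where "g1 x t = u1 x t + v1 x t" for x t
  define g2 where "g2 x t = u2 x t + v2 x t" for x t
  \<comment> \<open>The time derivative of \<open>G\<close>, by the integrated equations for U and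
    V.\<close>
  define H where "H x t = 3 * ((u x t)\<^sup>2 + (v x t)\<^sup>2) - of_real \<alpha> * g2 x t" for x t
  note defs = P_def w_def w1_def w2_def w3_def G_def g_def g1_def g2_def
  define Pt where "Pt x t = 3 * g x t * w x t - of_real \<alpha> * w2 x t" for x t
  define wt where "wt x t = 3 * (g1 x t * w x t + g x t * w1 x t) - of_real \<alpha> * w3 x t" for x t
  define z where "z x t = w x t + c * (G x t * P x t)" for x t
  define z1 where "z1 x t = w1 x t + c * (G x t * w x t + g x t * P x t)" for x t
  define z2 where "z2 x t = w2 x t + c * (G x t * w1 x t + 2 * g x t * w x t + g1 x t * P x t)" for x t
  define z3 where "z3 x t = w3 x t + c * (G x t * w2 x t + 3 * g x t * w1 x t + 3 * g1 x t * w x t + g2 x t * P x t)" for x t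
  define zt where "zt x t = wt x t + c * (G x t * Pt x t + H x t * P x t)" for x t
  \<comment> \<open>What is left of the equation for \<open>z\<close> after its dispersive term: it
    contains P and w, but no derivative of w.\<close>
  define R where "R x t = (c * H x t - g2 x t) * P x t + 3 * c * G x t * g x t * w x t" for x t
  have zt: "zt x t = R x t - of_real \<alpha> * z3 x t" for x t
  proof -
    have "zt x t - (R x t - of_real \<alpha> * z3 x t) =
        (1 + of_real \<alpha> * c) * (3 * g x t * w1 x t + 3 * g1 x t * w x t + g2 x t * P x t)"
      unfolding zt_def R_def z3_def wt_def Pt_def by (simp add: algebra_simps)
    then show ?thesis by (simp add: ca)
  qed
  have cont: "continuous_on (?X \<times> {0..}) (\<lambda>p. P (fst p) (snd p))"
    "continuous_on (?X \<times> {0..}) (\<lambda>p. w (fst p) (snd p))"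
    "continuous_on (?X \<times> {0..}) (\<lambda>p. w1 (fst p) (snd p))"
    "continuous_on (?X \<times> {0..}) (\<lambda>p. w2 (fst p) (snd p))"
    "continuous_on (?X \<times> {0..}) (\<lambda>p. w3 (fst p) (snd p))"
    "continuous_on (?X \<times> {0..}) (\<lambda>p. G (fst p) (snd p))"
    "continuous_on (?X \<times> {0..}) (\<lambda>p. g (fst p) (snd p))"
    "continuous_on (?X \<times> {0..}) (\<lambda>p. g1 (fst p) (snd p))"
    "continuous_on (?X \<times> {0..}) (\<lambda>p. g2 (fst p) (snd p))"
    unfolding defs by (intro continuous_intros A.cont B.cont)+
  have contH: "continuous_on (?X \<times> {0..}) (\<lambda>p. H (fst p) (snd p))"
    unfolding H_def by (intro continuous_intros A.cont B.cont cont)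
  have contz: "continuous_on (?X \<times> {0..}) (\<lambda>p. z (fst p) (snd p))"
    "continuous_on (?X \<times> {0..}) (\<lambda>p. zt (fst p) (snd p))"
    "continuous_on (?X \<times> {0..}) (\<lambda>p. Pt (fst p) (snd p))"
    unfolding z_def zt_def wt_def Pt_def by (intro continuous_intros cont contH)+
  \<comment> \<open>Since w = z - c G P, the lower-order terms in the equations for P and z are
    bounded by |P| + |z| alone, with coefficients that are bounded on the compact time
    strip.\<close>
  have "\<exists>L\<ge>0. \<forall>x\<in>?X. \<forall>s. 0 \<le> s \<longrightarrow> s \<le> ?T \<longrightarrow>
      cmod (3 * g x s * w x s) \<le> L * (cmod (P x s) + cmod (z x s)) \<and>
      cmod (R x s) \<le> L * (cmod (P x s) + cmod (z x s))"
  proof -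
    have "\<exists>B\<ge>0. \<forall>x\<in>?X. \<forall>s. 0 \<le> s \<longrightarrow> s \<le> ?T \<longrightarrow> cmod (f x s) \<le> B"
      if "continuous_on (?X \<times> {0..}) (\<lambda>p. f (fst p) (snd p))" for f :: "real \<Rightarrow> real \<Rightarrow> complex"
      using continuous_on_bounded_strip[OF that, of ?T] by metis
    note bd = this
    have "continuous_on (?X \<times> {0..}) (\<lambda>p. - (c * G (fst p) (snd p)))"
      "continuous_on (?X \<times> {0..}) (\<lambda>p. 3 * g (fst p) (snd p))"
      "continuous_on (?X \<times> {0..}) (\<lambda>p. c * H (fst p) (snd p) - g2 (fst p) (snd p))"
      "continuous_on (?X \<times> {0..}) (\<lambda>p. 3 * c * G (fst p) (snd p) * g (fst p) (snd p))"
      by (intro continuous_intros cont contH)+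
    note cs = this
    obtain B1 where B1: "B1 \<ge> 0" "\<forall>x\<in>?X. \<forall>s. 0 \<le> s \<longrightarrow> s \<le> ?T \<longrightarrow> cmod (- (c * G x s)) \<le> B1"
      using bd[of "\<lambda>x s. - (c * G x s)"] cs(1) by blast
    obtain B2 where B2: "B2 \<ge> 0" "\<forall>x\<in>?X. \<forall>s. 0 \<le> s \<longrightarrow> s \<le> ?T \<longrightarrow> cmod (3 * g x s) \<le> B2"
      using bd[of "\<lambda>x s. 3 * g x s"] cs(2) by blast
    obtain B3 where B3: "B3 \<ge> 0" "\<forall>x\<in>?X. \<forall>s. 0 \<le> s \<longrightarrow> s \<le> ?T \<longrightarrow> cmod (c * H x s - g2 x s) \<le> B3"
      using bd[of "\<lambda>x s. c * H x s - g2 x s"] cs(3) by blast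
    obtain B4 where B4: "B4 \<ge> 0" "\<forall>x\<in>?X. \<forall>s. 0 \<le> s \<longrightarrow> s \<le> ?T \<longrightarrow> cmod (3 * c * G x s * g x s) \<le> B4"
      using bd[of "\<lambda>x s. 3 * c * G x s * g x s"] cs(4) by blast
    show ?thesis
    proof (intro exI conjI ballI allI impI)
      let ?D = "1 + B1" and ?L = "B2 * (1 + B1) + B3 + B4 * (1 + B1)"
      show "0 \<le> ?L" using B1 B2 B3 B4 by simp
      fix x s assume x: "x \<in> ?X" "0 \<le> s" "s \<le> ?T"
      let ?S = "cmod (P x s) + cmod (z x s)"
      have "?L * ?S = B2 * (?D * ?S) + B3 * ?S + B4 * (?D * ?S)" by (simp add: algebra_simps)
      moreover have "0 \<le> B2 * (?D * ?S)" "0 \<le> B3 * ?S" "0 \<le> B4 * (?D * ?S)"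
        using B1(1) B2(1) B3(1) B4(1) by simp_all
      ultimately have L: "B2 * (?D * ?S) \<le> ?L * ?S" "B3 * ?S + B4 * (?D * ?S) \<le> ?L * ?S"
        by linarith+
      have "w x s = z x s + - (c * G x s) * P x s" by (simp add: z_def)
      then have "cmod (w x s) \<le> cmod (z x s) + cmod (- (c * G x s)) * cmod (P x s)"
        by (metis norm_mult norm_triangle_ineq)
      also have "\<dots> \<le> cmod (z x s) + B1 * cmod (P x s)"
        using B1 x by (intro add_left_mono mult_right_mono) auto
      also have "\<dots> \<le> ?D * ?S" using B1(1) by (simp add: algebra_simps)
      finally have w: "cmod (w x s) \<le> ?D * ?S" .
      have "cmod (3 * g x s * w x s) \<le> B2 * (?D * ?S)"
        unfolding norm_mult[of "3 * g x s"] using B2 x w by (intro mult_mono) auto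
      also note L(1)
      finally show "cmod (3 * g x s * w x s) \<le> ?L * ?S" .
      have "cmod (R x s) \<le> cmod (c * H x s - g2 x s) * cmod (P x s) + cmod (3 * c * G x s * g x s) * cmod (w x s)"
        unfolding R_def by (metis norm_mult norm_triangle_ineq)
      also have "\<dots> \<le> B3 * ?S + B4 * (?D * ?S)"
        using B3 B4 x w by (intro add_mono mult_mono) auto
      also note L(2)
      finally show "cmod (R x s) \<le> ?L * ?S" .
    qed
  qed
  then obtain L where L: "L \<ge> 0" "\<And>x s. x \<in> ?X \<Longrightarrow> 0 \<le> s \<Longrightarrow> s \<le> ?T \<Longrightarrow>
      cmod (3 * g x s * w x s) \<le> L * (cmod (P x s) + cmod (z x s)) \<and>
      cmod (R x s) \<le> L * (cmod (P x s) + cmod (z x s))" by blast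
  have "P x t \<bullet> P x t + z x t \<bullet> z x t = 0"
  proof (rule conservation_gronwall[where q="\<lambda>x t. P x t \<bullet> P x t + z x t \<bullet> z x t"
        and q'="\<lambda>x t. 2 * (P x t \<bullet> Pt x t) + 2 * (z x t \<bullet> zt x t)" and T="?T" and K="4 * L"
        and \<Phi>="\<lambda>x t. (- 2 * \<alpha> * (P x t \<bullet> w1 x t) + \<alpha> * (w x t \<bullet> w x t) + 2 * 0 * (P x t \<bullet> w x t)) +
          (- 2 * \<alpha> * (z x t \<bullet> z2 x t) + \<alpha> * (z1 x t \<bullet> z1 x t) + 2 * 0 * (z x t \<bullet> z1 x t))"
        and \<Phi>'="\<lambda>x t. (2 * (P x t \<bullet> (0 *\<^sub>R w1 x t - \<alpha> *\<^sub>R w2 x t)) + 2 * 0 * (w x t \<bullet> w x t)) +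
          (2 * (z x t \<bullet> (0 *\<^sub>R z2 x t - \<alpha> *\<^sub>R z3 x t)) + 2 * 0 * (z1 x t \<bullet> z1 x t))", OF _ _ _ _ _ _ _ _ _ x(1) x(2)])
    show "P x 0 \<bullet> P x 0 + z x 0 \<bullet> z x 0 = 0" if "x \<in> ?X" for x
      using init that by (simp add: P_def z_def w_def)
    show "continuous_on (?X \<times> {0..?T}) (\<lambda>p. P (fst p) (snd p) \<bullet> P (fst p) (snd p) + z (fst p) (snd p) \<bullet> z (fst p) (snd p))"
      by (intro continuous_intros cont[THEN continuous_on_subset] contz[THEN continuous_on_subset]) auto
    show "continuous_on (?X \<times> {0<..<?T}) (\<lambda>p. 2 * (P (fst p) (snd p) \<bullet> Pt (fst p) (snd p)) +
        2 * (z (fst p) (snd p) \<bullet> zt (fst p) (snd p)))"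
      by (intro continuous_intros cont[THEN continuous_on_subset] contz[THEN continuous_on_subset]) auto
    fix x s assume x: "x \<in> ?X" and s: "0 < s" "s < ?T"
    have dG: "((\<lambda>s. G x s) has_vector_derivative H x s) (at s)"
    proof -
      have "((\<lambda>s. G x s) has_vector_derivative
         (3 * (u x s)\<^sup>2 - of_real \<alpha> * u2 x s + of_real 0 * u1 x s) +
         (3 * (v x s)\<^sup>2 - of_real \<alpha> * v2 x s + of_real 0 * v1 x s)) (at s)"
        unfolding G_def by (intro has_vector_derivative_add A.dt B.dt x s)
      then show ?thesis by (simp add: H_def g2_def algebra_simps)
    qed
    have dP: "((\<lambda>s. P x s) has_vector_derivative Pt x s) (at s)"
    proof -
      have "((\<lambda>s. P x s) has_vector_derivative
         (3 * (v x s)\<^sup>2 - of_real \<alpha> * v2 x s + of_real 0 * v1 x s) -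
         (3 * (u x s)\<^sup>2 - of_real \<alpha> * u2 x s + of_real 0 * u1 x s)) (at s)"
        unfolding P_def by (intro has_vector_derivative_diff A.dt B.dt x s)
      then show ?thesis by (simp add: Pt_def defs algebra_simps power2_eq_square)
    qed
    have dw: "((\<lambda>s. w x s) has_vector_derivative wt x s) (at s)"
    proof -
      have "((\<lambda>s. w x s) has_vector_derivative
         (6 * v x s * v1 x s - of_real \<alpha> * v3 x s + of_real 0 * v2 x s) -
         (6 * u x s * u1 x s - of_real \<alpha> * u3 x s + of_real 0 * u2 x s)) (at s)"
        unfolding w_def by (intro has_vector_derivative_diff A.dt B.dt x s)
      then show ?thesis by (simp add: wt_def defs algebra_simps)
    qed
    have dz: "((\<lambda>s. z x s) has_vector_derivative zt x s) (at s)"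
      unfolding z_def zt_def
      by (intro has_vector_derivative_add has_vector_derivative_mult_right has_vector_derivative_mult dP dw dG)
    have "((\<lambda>s. P x s \<bullet> P x s + z x s \<bullet> z x s) has_vector_derivative
        (P x s \<bullet> Pt x s + Pt x s \<bullet> P x s) + (z x s \<bullet> zt x s + zt x s \<bullet> z x s)) (at s)"
      by (intro has_vector_derivative_add inner_has_vector_derivative dP dz)
    then show "((\<lambda>s. P x s \<bullet> P x s + z x s \<bullet> z x s) has_vector_derivative
        2 * (P x s \<bullet> Pt x s) + 2 * (z x s \<bullet> zt x s)) (at s)"
      by (simp add: inner_commute)
    have xP: "((\<lambda>y. P y s) has_vector_derivative w x s) (at x within ?X)"
      and xw: "((\<lambda>y. w y s) has_vector_derivative w1 x s) (at x within ?X)"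
        "((\<lambda>y. w1 y s) has_vector_derivative w2 x s) (at x within ?X)"
        "((\<lambda>y. w2 y s) has_vector_derivative w3 x s) (at x within ?X)"
      unfolding defs using x s by (intro has_vector_derivative_diff A.dx B.dx; simp)+
    have xG: "((\<lambda>y. G y s) has_vector_derivative g x s) (at x within ?X)"
      "((\<lambda>y. g y s) has_vector_derivative g1 x s) (at x within ?X)"
      "((\<lambda>y. g1 y s) has_vector_derivative g2 x s) (at x within ?X)"
      unfolding defs using x s by (intro has_vector_derivative_add A.dx B.dx; simp)+
    note rules = has_vector_derivative_add has_vector_derivative_mult_right has_vector_derivative_mult xP xw xG
    have xz: "((\<lambda>y. z y s) has_vector_derivative z1 x s) (at x within ?X)"
      unfolding z_def z1_def by (intro rules)
    have xz1: "((\<lambda>y. z1 y s) has_vector_derivative z2 x s) (at x within ?X)"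
    proof -
      have "((\<lambda>y. z1 y s) has_vector_derivative w2 x s +
        c * ((G x s * w1 x s + g x s * w x s) + (g x s * w x s + g1 x s * P x s))) (at x within ?X)"
        unfolding z1_def by (intro rules)
      then show ?thesis by (simp add: z2_def algebra_simps)
    qed
    have xz2: "((\<lambda>y. z2 y s) has_vector_derivative z3 x s) (at x within ?X)"
    proof -
      have "((\<lambda>y. z2 y s) has_vector_derivative w3 x s +
        c * ((G x s * w2 x s + g x s * w1 x s) + (2 * g x s * w1 x s + 2 * g1 x s * w x s) +
          (g1 x s * w x s + g2 x s * P x s))) (at x within ?X)"
        unfolding z2_def by (intro rules)
      then show ?thesis by (simp add: z3_def algebra_simps)
    qed
    show "((\<lambda>x. (- 2 * \<alpha> * (P x s \<bullet> w1 x s) + \<alpha> * (w x s \<bullet> w x s) + 2 * 0 * (P x s \<bullet> w x s)) +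
          (- 2 * \<alpha> * (z x s \<bullet> z2 x s) + \<alpha> * (z1 x s \<bullet> z1 x s) + 2 * 0 * (z x s \<bullet> z1 x s))) has_vector_derivative
        (2 * (P x s \<bullet> (0 *\<^sub>R w1 x s - \<alpha> *\<^sub>R w2 x s)) + 2 * 0 * (w x s \<bullet> w x s)) +
          (2 * (z x s \<bullet> (0 *\<^sub>R z2 x s - \<alpha> *\<^sub>R z3 x s)) + 2 * 0 * (z1 x s \<bullet> z1 x s))) (at x within ?X)"
      by (intro has_vector_derivative_add[OF energy_flux_has_vector_derivative energy_flux_has_vector_derivative]
        xP xw xz xz1 xz2)
    define p y where "p = cmod (P x s)" and "y = cmod (z x s)"
    have "P x s \<bullet> (3 * g x s * w x s) \<le> p * cmod (3 * g x s * w x s)"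
      "z x s \<bullet> R x s \<le> y * cmod (R x s)"
      unfolding p_def y_def by (rule norm_cauchy_schwarz)+
    moreover have "p * cmod (3 * g x s * w x s) \<le> p * (L * (p + y))" "y * cmod (R x s) \<le> y * (L * (p + y))"
      using L(2)[of x s] x s unfolding p_def y_def by (auto intro!: mult_left_mono)
    ultimately have "2 * (P x s \<bullet> (3 * g x s * w x s)) + 2 * (z x s \<bullet> R x s) \<le> 2 * L * (p + y)\<^sup>2"
      by (simp add: power2_eq_square algebra_simps)
    \<comment> \<open>From (p + y)^2 \<le> 2 (p^2 + y^2) comes the Gronwall constant 4 L.\<close>
    also have "\<dots> \<le> 2 * L * (2 * (p\<^sup>2 + y\<^sup>2))"
      using L(1) sum_squares_ge_zero[of "p - y" 0]
      by (intro mult_left_mono) (simp_all add: power2_eq_square algebra_simps)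
    also have "\<dots> = 4 * L * (P x s \<bullet> P x s + z x s \<bullet> z x s)"
      by (simp add: p_def y_def power2_norm_eq_inner)
    finally have main: "2 * (P x s \<bullet> (3 * g x s * w x s)) + 2 * (z x s \<bullet> R x s) \<le>
        4 * L * (P x s \<bullet> P x s + z x s \<bullet> z x s)" .
    have "P x s \<bullet> Pt x s = P x s \<bullet> (3 * g x s * w x s) - P x s \<bullet> (\<alpha> *\<^sub>R w2 x s)"
      "z x s \<bullet> zt x s = z x s \<bullet> R x s - z x s \<bullet> (\<alpha> *\<^sub>R z3 x s)"
      unfolding Pt_def zt scaleR_conv_of_real by (simp_all only: inner_diff_right)
    with main show "2 * (P x s \<bullet> Pt x s) + 2 * (z x s \<bullet> zt x s) \<le>
        (2 * (P x s \<bullet> (0 *\<^sub>R w1 x s - \<alpha> *\<^sub>R w2 x s)) + 2 * 0 * (w x s \<bullet> w x s)) +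
          (2 * (z x s \<bullet> (0 *\<^sub>R z2 x s - \<alpha> *\<^sub>R z3 x s)) + 2 * 0 * (z1 x s \<bullet> z1 x s)) +
        4 * L * (P x s \<bullet> P x s + z x s \<bullet> z x s)"
      by (simp add: inner_diff_right)
  qed (auto simp: defs z_def z1_def z2_def A.periodic B.periodic)
  then have "P x t \<bullet> P x t = 0" by (smt (verit) inner_ge_zero)
  then show ?thesis by (simp add: P_def)
qed

section \<open>From a classical solution to a periodic antiderivative\<close>

lemma global_solution_potential:
  assumes sol: "global_solution \<alpha> \<nu> u0 u" and mean: "integral {0..2*pi} u0 = 0"
  shows "\<exists>U u1 u2 u3. kdvb_potential \<alpha> \<nu> U u u1 u2 u3 \<and> (\<forall>x. U x 0 = integral {0..x} u0)"
proof -
  from sol obtain u1 u2 u3 where D: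
    "\<forall>t\<ge>0. \<forall>x. u (x + 2 * pi) t = u x t" "\<forall>x. u x 0 = u0 x"
    "continuous_on (UNIV \<times> {0..}) (\<lambda>(x, t). u x t)"
    "continuous_on (UNIV \<times> {0..}) (\<lambda>(x, t). u1 x t)"
    "continuous_on (UNIV \<times> {0..}) (\<lambda>(x, t). u2 x t)"
    "continuous_on (UNIV \<times> {0..}) (\<lambda>(x, t). u3 x t)"
    "\<forall>t\<ge>0. \<forall>x. ((\<lambda>y. u y t) has_vector_derivative u1 x t) (at x)"
    "\<forall>t\<ge>0. \<forall>x. ((\<lambda>y. u1 y t) has_vector_derivative u2 x t) (at x)"
    "\<forall>t\<ge>0. \<forall>x. ((\<lambda>y. u2 y t) has_vector_derivative u3 x t) (at x)"
    "\<forall>t>0. \<forall>x. \<exists>ut. ((\<lambda>\<tau>. u x \<tau>) has_vector_derivative ut) (at t) \<and>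
       ut - 6 * u x t * u1 x t + of_real \<alpha> * u3 x t - of_real \<nu> * u2 x t = 0"
    unfolding global_solution_def by (elim conjE exE) (rule that)
  note per = D(1)[rule_format] and init = D(2)[rule_format] and c = D(3-6)
    and d = D(7-9)[rule_format] and pde = D(10)[rule_format]
  have per1: "u1 (x + 2 * pi) t = u1 x t" if "t \<ge> 0" for x t
    using periodic_imp_vector_derivative_periodic[OF per[OF that] d(1)[OF that]] .
  have per2: "u2 (x + 2 * pi) t = u2 x t" if "t \<ge> 0" for x t
    using periodic_imp_vector_derivative_periodic[of "\<lambda>x. u1 x t", OF per1[OF that] d(2)[OF that]] .
  define ut where "ut x t = 6 * u x t * u1 x t - of_real \<alpha> * u3 x t + of_real \<nu> * u2 x t" for x t
  \<comment> \<open>The flux of the equation in conservation form: u_t is the x-derivative of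
    \<open>h\<close>.\<close>
  define h where "h x t = 3 * (u x t)\<^sup>2 - of_real \<alpha> * u2 x t + of_real \<nu> * u1 x t" for x t
  have dut: "((\<lambda>s. u x s) has_vector_derivative ut x t) (at t)" if t: "t > 0" for x t
  proof -
    obtain r where r: "((\<lambda>\<tau>. u x \<tau>) has_vector_derivative r) (at t)"
      "r - 6 * u x t * u1 x t + of_real \<alpha> * u3 x t - of_real \<nu> * u2 x t = 0"
      using pde[OF t] by blast
    then have "r = ut x t" by (simp add: ut_def algebra_simps)
    with r show ?thesis by simp
  qed
  have dh: "((\<lambda>y. h y t) has_vector_derivative ut x t) (at x)" if "t \<ge> 0" for x t
  proof -
    have "((\<lambda>y. h y t) has_vector_derivative 3 * (u x t * u1 x t + u1 x t * u x t) - of_real \<alpha> * u3 x t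
       + of_real \<nu> * u2 x t) (at x)"
      unfolding h_def power2_eq_square
      by (intro has_vector_derivative_add has_vector_derivative_diff has_vector_derivative_mult_right
          has_vector_derivative_mult d that)
    then show ?thesis by (simp add: ut_def algebra_simps)
  qed
  have c': "continuous_on (S \<times> {0..}) (\<lambda>p. u (fst p) (snd p))"
    "continuous_on (S \<times> {0..}) (\<lambda>p. u1 (fst p) (snd p))"
    "continuous_on (S \<times> {0..}) (\<lambda>p. u2 (fst p) (snd p))"
    "continuous_on (S \<times> {0..}) (\<lambda>p. u3 (fst p) (snd p))" for S
    using c by (auto simp: split_beta elim: continuous_on_subset)
  have ch: "continuous_on (S \<times> {0..}) (\<lambda>p. h (fst p) (snd p))" for S
    unfolding h_def by (intro continuous_intros c')
  have cut: "continuous_on (S \<times> {0..}) (\<lambda>p. ut (fst p) (snd p))" for S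
    unfolding ut_def by (intro continuous_intros c')
  have ch0: "continuous_on {0..} (h 0)"
    using continuous_on_slices(2)[OF ch[of UNIV], of 0 "{0..}"] by simp
  have cu: "continuous_on S (\<lambda>y. u y t)" if "t \<ge> 0" for S t
    using continuous_on_slices(1)[OF c'(1)[of UNIV]] that by simp
  define I where "I x t = integral {0..x} (\<lambda>y. u y t)" for x t
  \<comment> \<open>The antiderivative \<open>I\<close> based at x = 0 has time derivative h(x) -
    h(0); adding \<open>J\<close> restores h(x), so that the integrated equation holds without an
    integration constant.\<close>
  define J where "J t = integral {0..t} (h 0)" for t
  have dI: "((\<lambda>s. I x s) has_vector_derivative h x t - h 0 t) (at t)" if "x \<ge> 0" "t > 0" for x t
  proof -
    have "((\<lambda>s. integral (cbox 0 x) (\<lambda>y. u y s)) has_vector_derivative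
        integral (cbox 0 x) (\<lambda>y. ut y t)) (at t within {0<..})"
    proof (rule leibniz_rule_vector_derivative)
      show "((\<lambda>s. u y s) has_vector_derivative ut y s) (at s within {0<..})" if "s \<in> {0<..}" for y s
        using dut that has_vector_derivative_at_within by blast
      show "(\<lambda>y. u y s) integrable_on cbox 0 x" if "s \<in> {0<..}" for s
        using cu[of s "cbox 0 x"] that by (intro integrable_continuous) simp
      show "continuous_on ({0<..} \<times> cbox 0 x) (\<lambda>(s, y). ut y s)"
      proof -
        have "continuous_on ({0<..} \<times> cbox 0 x) (\<lambda>z. ut (fst (prod.swap z)) (snd (prod.swap z)))"
          by (rule continuous_on_compose2[OF cut[of UNIV] continuous_on_swap]) auto
        then show ?thesis by (simp add: split_beta)
      qed
    qed (use that in auto)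
    moreover have "((\<lambda>y. ut y t) has_integral h x t - h 0 t) {0..x}"
      using that by (intro fundamental_theorem_of_calculus) (auto intro!: has_vector_derivative_at_within[OF dh])
    ultimately show ?thesis
      using that by (simp add: I_def[abs_def] integral_unique at_within_open[of t "{0<..}"])
  qed
  have dJ: "(J has_vector_derivative h 0 t) (at t)" if "t > 0" for t
  proof -
    have "(J has_vector_derivative h 0 t) (at t within {0..t+1})"
      unfolding J_def[abs_def] using that continuous_on_subset[OF ch0]
      by (intro integral_has_vector_derivative) auto
    then show ?thesis using that at_within_interior[of t "{0..t+1}"] by simp
  qed
  have cI: "continuous_on ({0..2*pi} \<times> {0..}) (\<lambda>p. I (fst p) (snd p))"
    unfolding I_def by (rule integral_upto_continuous_on[OF c'(1)])
  have cJ: "continuous_on {0..} J"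
  proof (subst continuous_on_eq_continuous_within, rule ballI)
    fix t :: real assume "t \<in> {0..}"
    have "(J has_vector_derivative h 0 t) (at t within {0..t+1})"
      unfolding J_def[abs_def] using \<open>t \<in> {0..}\<close> continuous_on_subset[OF ch0]
      by (intro integral_has_vector_derivative) auto
    moreover have "at t within {0..t+1} = at t within {0..}"
      by (rule at_within_nhd[where S="{..<t+1}"]) auto
    ultimately show "continuous (at t within {0..}) J"
      using has_vector_derivative_continuous by metis
  qed
  \<comment> \<open>The time derivative of the mean is h(2 pi) - h(0), which periodicity makes zero,
    so the vanishing mean of the datum persists.\<close>
  have mean0: "I (2*pi) t = 0" if "t \<ge> 0" for t
  proof (cases "t = 0")
    case True
    then show ?thesis using mean by (simp add: I_def init)
  next
    case False
    with that have t: "0 < t" by simp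
    have "norm (I (2*pi) t - I (2*pi) 0) \<le> (\<lambda>_. 0) t - (\<lambda>_. 0::real) 0"
    proof (rule differentiable_bound_general[OF t])
      show "continuous_on {0..t} (\<lambda>s. I (2*pi) s)"
        by (rule continuous_on_slices(2)[OF cI]) auto
      fix s assume s: "0 < s" "s < t"
      show "((\<lambda>s. I (2*pi) s) has_vector_derivative h (2*pi) s - h 0 s) (at s)" using dI s by simp
      show "((\<lambda>_. 0::real) has_vector_derivative 0) (at s)" by simp
      show "norm (h (2*pi) s - h 0 s) \<le> 0"
        using per[of s 0] per1[of s 0] per2[of s 0] s by (simp add: h_def)
    qed auto
    then show ?thesis using mean by (simp add: I_def init)
  qed
  define U where "U x t = I x t + J t" for x t
  have "kdvb_potential \<alpha> \<nu> U u u1 u2 u3"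
  proof
    show "continuous_on ({0..2*pi} \<times> {0..}) (\<lambda>p. U (fst p) (snd p))"
      unfolding U_def by (intro continuous_intros cI continuous_on_compose2[OF cJ]) auto
    fix x t :: real assume x: "x \<in> {0..2*pi}"
    show "((\<lambda>y. U y t) has_vector_derivative u x t) (at x within {0..2*pi})" if "t \<ge> 0"
    proof -
      have "((\<lambda>y. U y t) has_vector_derivative u x t + 0) (at x within {0..2*pi})"
        unfolding U_def I_def
        by (intro has_vector_derivative_add integral_has_vector_derivative cu that x
            has_vector_derivative_const)
      then show ?thesis by simp
    qed
    show "((\<lambda>s. U x s) has_vector_derivative 3 * (u x t)\<^sup>2 - of_real \<alpha> * u2 x t + of_real \<nu> * u1 x t) (at t)"
      if "t > 0"
    proof -
      have "((\<lambda>s. U x s) has_vector_derivative (h x t - h 0 t) + h 0 t) (at t)"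
        unfolding U_def using x that by (intro has_vector_derivative_add dI dJ) auto
      then show ?thesis by (simp add: h_def)
    qed
    show "((\<lambda>s. u x s) has_vector_derivative 6 * u x t * u1 x t - of_real \<alpha> * u3 x t + of_real \<nu> * u2 x t) (at t)"
      if "t > 0" using dut[OF that] by (simp add: ut_def)
  next
    fix t :: real assume t: "t \<ge> 0"
    show "U (2*pi) t = U 0 t" using mean0[OF t] by (simp add: U_def I_def)
    show "u (2*pi) t = u 0 t" "u1 (2*pi) t = u1 0 t" "u2 (2*pi) t = u2 0 t"
      using per[OF t, of 0] per1[OF t, of 0] per2[OF t, of 0] by simp_all
  qed (use c' d[THEN has_vector_derivative_at_within] in blast)+
  moreover have "U x 0 = integral {0..x} u0" for x by (simp add: U_def I_def J_def init)
  ultimately show ?thesis by blast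
qed

lemma periodic_eqI:
  fixes f g :: "real \<Rightarrow> 'a"
  assumes "p > 0" "\<And>x. f (x + p) = f x" "\<And>x. g (x + p) = g x"
    and eq: "\<And>x. x \<in> {0..p} \<Longrightarrow> f x = g x"
  shows "f x = g x"
proof -
  have shift: "F (y + of_int n * p) = F y" if "\<And>x. F (x + p) = F x" for F :: "real \<Rightarrow> 'a" and y n
  proof (induction n rule: int_induct[where k=0])
    case (step1 i)
    then show ?case using that[of "y + of_int i * p"] by (simp add: algebra_simps)
  next
    case (step2 i)
    then show ?case using that[of "y + of_int (i - 1) * p"] by (simp add: algebra_simps)
  qed simp
  define n where "n = \<lfloor>x / p\<rfloor>"
  have "x - of_int n * p \<in> {0..p}"
    using \<open>p > 0\<close> floor_divide_lower[of p x] floor_divide_upper[of p x] by (auto simp: n_def algebra_simps)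
  from eq[OF this] shift[of f, OF assms(2), of "x - of_int n * p" n] shift[of g, OF assms(3), of "x - of_int n * p" n]
  show ?thesis by (metis diff_add_cancel)
qed

lemma global_solutionD:
  assumes "global_solution \<alpha> \<nu> u0 u"
  shows "t \<ge> 0 \<Longrightarrow> u (x + 2 * pi) t = u x t" and "u x 0 = u0 x"
  using assms[unfolded global_solution_def, THEN conjunct1]
    assms[unfolded global_solution_def, THEN conjunct2, THEN conjunct1] by simp_all

text \<open>Both antiderivatives start from the same integral of \<open>u0\<close>, hence agree at
  all times; differentiating them in x recovers the solutions on one period.\<close>

lemma global_solution_unique:
  assumes u: "global_solution \<alpha> \<nu> u0 u" and v: "global_solution \<alpha> \<nu> u0 v"
    and mean: "integral {0..2*pi} u0 = 0" and "\<nu> \<ge> 0" "\<nu> > 0 \<or> \<alpha> \<noteq> 0" and t: "t \<ge> 0"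
  shows "v x t = u x t"
proof (rule periodic_eqI[of "2 * pi" "\<lambda>x. v x t" "\<lambda>x. u x t"])
  show "v (x + 2*pi) t = v x t" "u (x + 2*pi) t = u x t" for x
    using global_solutionD(1)[OF u t] global_solutionD(1)[OF v t] by simp_all
  obtain U u1 u2 u3 where U: "kdvb_potential \<alpha> \<nu> U u u1 u2 u3" "\<And>x. U x 0 = integral {0..x} u0"
    using global_solution_potential[OF u mean] by blast
  obtain V v1 v2 v3 where V: "kdvb_potential \<alpha> \<nu> V v v1 v2 v3" "\<And>x. V x 0 = integral {0..x} u0"
    using global_solution_potential[OF v mean] by blast
  interpret U: kdvb_potential \<alpha> \<nu> U u u1 u2 u3 by (rule U)
  interpret V: kdvb_potential \<alpha> \<nu> V v v1 v2 v3 by (rule V)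
  have init: "v x 0 = u x 0" for x
    using global_solutionD(2)[OF u] global_solutionD(2)[OF v] by simp
  have eq: "V x t = U x t" if "x \<in> {0..2*pi}" for x
  proof (cases "\<nu> > 0")
    case True
    show ?thesis using potential_unique_viscous[OF U(1) V(1) True _ that t] U(2) V(2) by simp
  next
    case False
    then have 0: "\<nu> = 0" "\<alpha> \<noteq> 0" using assms by auto
    show ?thesis
      using potential_unique_inviscid[OF U(1)[unfolded 0] V(1)[unfolded 0] 0(2) _ init that t] U(2) V(2) by simp
  qed
  fix x assume x: "x \<in> {0..2*pi}"
  have "((\<lambda>y. U y t) has_vector_derivative v x t) (at x within {0..2*pi})"
    by (rule has_vector_derivative_transform[OF x _ V.dx(1)[OF x t]]) (simp add: eq)
  then show "v x t = u x t"
    using vector_derivative_unique_within_closed_interval[of 0 "2*pi" x] U.dx(1)[OF x t] x by auto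
qed simp

section \<open>The Fourier series of the solution\<close>

text \<open>Split r^k = q^k q^k with q = sqrt r: one factor absorbs a power of k, the other carries
  the remaining ones. The induction hypothesis is thus applied at q instead of r.\<close>

lemma summable_power_mult_geometric:
  fixes r :: real
  assumes "0 \<le> r" "r < 1"
  shows "summable (\<lambda>k. real k ^ m * r ^ k)"
  using assms
proof (induction m arbitrary: r)
  case 0
  then show ?case by (simp add: summable_geometric)
next
  case (Suc m)
  define q where "q = sqrt r"
  have q: "0 \<le> q" "q < 1" "r = q * q" using Suc.prems by (auto simp: q_def)
  then have "(\<lambda>k. real k * q ^ k) \<longlonglongrightarrow> 0" by (intro powser_times_n_limit_0) simp
  then have "Bseq (\<lambda>k. real k * q ^ k)" by (intro convergent_imp_Bseq convergentI)
  then obtain K where "\<forall>k. norm (real k * q ^ k) \<le> K" by (rule BseqE)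
  then have K: "norm (real k * q ^ k) \<le> K" for k by blast
  show ?case
  proof (rule summable_comparison_test[OF _ summable_mult[OF Suc.IH[OF q(1,2)], of K]], intro exI allI impI)
    fix k
    have "norm (real k ^ Suc m * r ^ k) = norm (real k * q ^ k) * (real k ^ m * q ^ k)"
      using q by (simp add: power_mult_distrib)
    also have "\<dots> \<le> K * (real k ^ m * q ^ k)" using q by (intro mult_right_mono K) auto
    finally show "norm (real k ^ Suc m * r ^ k) \<le> K * (real k ^ m * q ^ k)" .
  qed
qed

lemma has_vector_derivative_suminf:
  fixes f f' :: "nat \<Rightarrow> real \<Rightarrow> 'a::banach"
  assumes S: "open S" "convex S"
    and f: "\<And>k x. x \<in> S \<Longrightarrow> (f k has_vector_derivative f' k x) (at x)"
    and M: "\<And>k x. x \<in> S \<Longrightarrow> norm (f' k x) \<le> M k" "summable M"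
    and sf: "\<And>x. x \<in> S \<Longrightarrow> summable (\<lambda>k. f k x)" and x: "x \<in> S"
  shows "((\<lambda>x. \<Sum>k. f k x) has_vector_derivative (\<Sum>k. f' k x)) (at x)"
proof -
  have unif: "uniform_limit S (\<lambda>n x. \<Sum>k<n. f' k x) (\<lambda>x. \<Sum>k. f' k x) sequentially"
    by (rule Weierstrass_m_test[OF M])
  have "\<exists>g. \<forall>x\<in>S. (\<lambda>n. f n x) sums g x \<and> (g has_derivative (\<lambda>h. h *\<^sub>R (\<Sum>k. f' k x))) (at x within S)"
  proof (rule has_derivative_series[OF S(2) _ _ x])
    show "(f n has_derivative (\<lambda>h. h *\<^sub>R f' n x)) (at x within S)" if "x \<in> S" for n x
      using f[OF that, of n] unfolding has_vector_derivative_def by (rule has_derivative_at_withinI)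
    show "(\<lambda>n. f n x) sums (\<Sum>k. f k x)" using sf[OF x] by (rule summable_sums)
    fix e :: real assume "e > 0"
    from uniform_limitD[OF unif this]
    show "\<forall>\<^sub>F n in sequentially. \<forall>x\<in>S. \<forall>h. norm ((\<Sum>i<n. h *\<^sub>R f' i x) - h *\<^sub>R (\<Sum>k. f' k x)) \<le> e * norm h"
    proof eventually_elim
      case (elim n)
      show ?case
      proof (intro ballI allI)
        fix x h assume "x \<in> S"
        have "norm ((\<Sum>i<n. h *\<^sub>R f' i x) - h *\<^sub>R (\<Sum>k. f' k x)) = \<bar>h\<bar> * norm ((\<Sum>i<n. f' i x) - (\<Sum>k. f' k x))"
          by (simp add: scaleR_sum_right[symmetric] scaleR_diff_right[symmetric])
        also have "\<dots> \<le> \<bar>h\<bar> * e"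
          using elim \<open>x \<in> S\<close> by (intro mult_left_mono) (auto simp: dist_norm less_imp_le)
        finally show "norm ((\<Sum>i<n. h *\<^sub>R f' i x) - h *\<^sub>R (\<Sum>k. f' k x)) \<le> e * norm h"
          by (simp add: mult.commute)
      qed
    qed
  qed
  then obtain g where g: "\<And>x. x \<in> S \<Longrightarrow> (\<lambda>n. f n x) sums g x"
    "\<And>x. x \<in> S \<Longrightarrow> (g has_derivative (\<lambda>h. h *\<^sub>R (\<Sum>k. f' k x))) (at x within S)" by blast
  have "(g has_vector_derivative (\<Sum>k. f' k x)) (at x)"
    using g(2)[OF x] unfolding has_vector_derivative_def at_within_open[OF x S(1)] .
  then show ?thesis
    by (rule has_vector_derivative_transform_within_open[OF _ S(1) x]) (rule sums_unique[OF g(1)])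
qed

section \<open>Solutions built from geometrically decaying modes\<close>

definition wave :: "nat \<Rightarrow> real \<Rightarrow> complex" where
  "wave k x = exp (\<i> * of_nat k * of_real x)"

lemma norm_wave [simp]: "cmod (wave k x) = 1"
  by (simp add: wave_def)

lemma wave_mult: "j \<le> k \<Longrightarrow> wave j x * wave (k - j) x = wave k x"
  by (simp add: wave_def exp_add[symmetric] of_nat_diff algebra_simps)

lemma wave_periodic: "wave k (x + 2 * pi) = wave k x"
proof -
  have "wave k (x + 2 * pi) = wave k x * exp ((2 * of_nat k * of_real pi) * \<i>)"
    unfolding wave_def exp_add[symmetric] by (simp add: algebra_simps)
  also have "exp ((2 * of_nat k * of_real pi) * \<i>) = 1"
    using exp_integer_2pi[of "real k"] by simp
  finally show ?thesis by simp
qed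

lemma wave_has_vector_derivative:
  "(wave k has_vector_derivative \<i> * of_nat k * wave k x) (at x)"
  unfolding wave_def[abs_def] by (rule exp_line_has_vector_derivative)

text \<open>The decay is uniform in time. Every derivative in x or t costs only powers of k, so one
  summable majorant per derivative serves all x and all t \<ge> 0 and allows termwise
  differentiation.\<close>

locale mode_decay =
  fixes \<alpha> \<nu> r B :: real and A :: complex and a :: "nat \<Rightarrow> real \<Rightarrow> complex"
  assumes sys: "mode_system \<alpha> \<nu> A a"
    and r: "0 \<le> r" "r < 1" and B: "B \<ge> 0"
    and decay: "\<And>k t. t \<ge> 0 \<Longrightarrow> cmod (a k t) \<le> B * real k * r ^ k"
begin

definition coeff_dx :: "nat \<Rightarrow> nat \<Rightarrow> real \<Rightarrow> complex" where
  "coeff_dx p k t = (\<i> * of_nat k) ^ p * a k t"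

definition series_dx :: "nat \<Rightarrow> real \<Rightarrow> real \<Rightarrow> complex" where
  "series_dx p x t = (\<Sum>k. coeff_dx p k t * wave k x)"

lemma summable_bound: "summable (\<lambda>k. B * (real k ^ p * r ^ k))"
  by (intro summable_mult summable_power_mult_geometric r)

lemma norm_coeff_dx: "t \<ge> 0 \<Longrightarrow> cmod (coeff_dx p k t) \<le> B * (real k ^ Suc p * r ^ k)"
  using mult_left_mono[OF decay[of t k], of "real k ^ p"]
  by (simp add: coeff_dx_def norm_mult norm_power ac_simps)

lemma summable_norm_series_dx: "t \<ge> 0 \<Longrightarrow> summable (\<lambda>k. norm (coeff_dx p k t * wave k x))"
  by (rule summable_comparison_test[OF _ summable_bound[of "Suc p"]])
    (use norm_coeff_dx in \<open>auto simp: norm_mult\<close>)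

lemma summable_series_dx: "t \<ge> 0 \<Longrightarrow> summable (\<lambda>k. coeff_dx p k t * wave k x)"
  by (rule summable_norm_cancel[OF summable_norm_series_dx])

lemma continuous_on_mode: "continuous_on {0..} (a k)"
proof (subst continuous_on_eq_continuous_within, rule ballI)
  fix t :: real assume "t \<in> {0..}"
  then show "continuous (at t within {0..}) (a k)"
    using mode_systemD(3)[OF sys, of t k] has_vector_derivative_continuous by auto
qed

lemma series_dx_continuous: "continuous_on (UNIV \<times> {0..}) (\<lambda>(x, t). series_dx p x t)"
proof -
  have "continuous_on (UNIV \<times> {0..}) (\<lambda>z. \<Sum>k. coeff_dx p k (snd z) * wave k (fst z))"
  proof (rule uniform_limit_theorem)
    show "uniform_limit (UNIV \<times> {0..}) (\<lambda>n z. \<Sum>k<n. coeff_dx p k (snd z) * wave k (fst z))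
        (\<lambda>z. \<Sum>k. coeff_dx p k (snd z) * wave k (fst z)) sequentially"
      by (rule Weierstrass_m_test[OF _ summable_bound[of "Suc p"]])
        (use norm_coeff_dx in \<open>auto simp: norm_mult\<close>)
    have "continuous_on (UNIV \<times> {0..}) (\<lambda>z. coeff_dx p k (snd z) * wave k (fst z))" for k
      unfolding coeff_dx_def wave_def
      by (intro continuous_intros continuous_on_compose2[OF continuous_on_mode]) auto
    then show "\<forall>\<^sub>F n in sequentially. continuous_on (UNIV \<times> {0..})
        (\<lambda>z. \<Sum>k<n. coeff_dx p k (snd z) * wave k (fst z))"
      by (intro always_eventually allI continuous_on_sum) auto
  qed simp
  then show ?thesis by (simp add: series_dx_def split_beta)
qed

lemma series_dx_has_vector_derivative:
  assumes "t \<ge> 0"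
  shows "((\<lambda>y. series_dx p y t) has_vector_derivative series_dx (Suc p) x t) (at x)"
  unfolding series_dx_def
proof (rule has_vector_derivative_suminf[OF open_UNIV convex_UNIV _ _ summable_bound[of "Suc (Suc p)"] summable_series_dx[OF assms]])
  fix k x
  have "((\<lambda>y. coeff_dx p k t * wave k y) has_vector_derivative
      coeff_dx p k t * (\<i> * of_nat k * wave k x)) (at x)"
    by (intro has_vector_derivative_mult_right wave_has_vector_derivative)
  then show "((\<lambda>y. coeff_dx p k t * wave k y) has_vector_derivative coeff_dx (Suc p) k t * wave k x) (at x)"
    by (simp add: coeff_dx_def ac_simps)
  show "norm (coeff_dx (Suc p) k t * wave k x) \<le> B * (real k ^ Suc (Suc p) * r ^ k)"
    using norm_coeff_dx[OF assms] by (simp only: norm_mult norm_wave mult_1_right)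
qed auto

text \<open>The two end terms vanish because \<open>a 0\<close> = 0; the full range is that of a
  Cauchy product.\<close>

lemma mode_source_alt: "mode_source a k t = 3 * \<i> * of_nat k * (\<Sum>j\<le>k. a j t * a (k - j) t)"
proof -
  have "(\<Sum>j=1..<k. a j t * a (k - j) t) = (\<Sum>j\<le>k. a j t * a (k - j) t)"
  proof (rule sum.mono_neutral_left)
    show "\<forall>j\<in>{..k} - {1..<k}. a j t * a (k - j) t = 0"
    proof
      fix j assume "j \<in> {..k} - {1..<k}"
      then have "j = 0 \<or> j = k" by auto
      then show "a j t * a (k - j) t = 0" using mode_systemD(1)[OF sys] by auto
    qed
  qed auto
  then show ?thesis by (simp add: mode_source_def)
qed

text \<open>Convolution preserves the ratio r, since r^j r^(k-j) = r^k. Fewer than k terms of size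
  B^2 k^2 r^k and the factor 3k of the derivative give k^4.\<close>

lemma norm_mode_source: 
  assumes "t \<ge> 0"
  shows "cmod (mode_source a k t) \<le> 3 * B\<^sup>2 * (real k ^ 4 * r ^ k)"
proof -
  have "cmod (\<Sum>j=1..<k. a j t * a (k - j) t) \<le> (\<Sum>j=1..<k. B\<^sup>2 * (real k)\<^sup>2 * r ^ k)"
  proof (rule sum_norm_le)
    fix j assume j: "j \<in> {1..<k}"
    have "cmod (a j t * a (k - j) t) \<le> (B * real j * r ^ j) * (B * real (k - j) * r ^ (k - j))"
      unfolding norm_mult using decay[OF assms] B r by (intro mult_mono) auto
    also have "\<dots> = B\<^sup>2 * (real j * real (k - j)) * (r ^ j * r ^ (k - j))"
      by (simp add: power2_eq_square)
    also have "\<dots> \<le> B\<^sup>2 * (real k * real k) * (r ^ j * r ^ (k - j))"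
      using j r by (intro mult_right_mono mult_left_mono mult_mono) auto
    also have "r ^ j * r ^ (k - j) = r ^ k" using j by (simp add: power_add[symmetric])
    finally show "cmod (a j t * a (k - j) t) \<le> B\<^sup>2 * (real k)\<^sup>2 * r ^ k"
      by (simp add: power2_eq_square)
  qed
  also have "\<dots> = real (k - 1) * (B\<^sup>2 * (real k)\<^sup>2 * r ^ k)" by simp
  also have "\<dots> \<le> real k * (B\<^sup>2 * (real k)\<^sup>2 * r ^ k)" using r by (intro mult_right_mono) auto
  finally have "3 * real k * cmod (\<Sum>j=1..<k. a j t * a (k - j) t) \<le>
      3 * real k * (real k * (B\<^sup>2 * (real k)\<^sup>2 * r ^ k))" by (intro mult_left_mono) auto
  then show ?thesis by (simp add: mode_source_def norm_mult power2_eq_square power4_eq_xxxx ac_simps)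
qed

text \<open>In the Cauchy product of u and u_x the symmetric products a_j a_(k-j) carry the weight k
  - j; averaging over j and k - j replaces it by k/2, which is 6 u u_x = 3 (u^2)_x on the Fourier
  side.\<close>

lemma series_burgers:
  assumes "t \<ge> 0"
  shows "(\<lambda>k. mode_source a k t * wave k x) sums (6 * series_dx 0 x t * series_dx 1 x t)"
proof -
  have "(\<lambda>k. 6 * (\<Sum>j\<le>k. (coeff_dx 0 j t * wave j x) * (coeff_dx 1 (k - j) t * wave (k - j) x)))
     sums (6 * (series_dx 0 x t * series_dx 1 x t))"
    unfolding series_dx_def
    by (intro sums_mult Cauchy_product_sums summable_norm_series_dx assms)
  moreover have "6 * (\<Sum>j\<le>k. (coeff_dx 0 j t * wave j x) * (coeff_dx 1 (k - j) t * wave (k - j) x)) =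
      mode_source a k t * wave k x" for k
  proof -
    let ?T = "\<lambda>j. a j t * a (k - j) t"
    have "(\<Sum>j\<le>k. (coeff_dx 0 j t * wave j x) * (coeff_dx 1 (k - j) t * wave (k - j) x)) =
        (\<Sum>j\<le>k. \<i> * wave k x * (of_nat (k - j) * ?T j))"
      by (rule sum.cong) (auto simp: coeff_dx_def wave_mult[symmetric])
    also have "\<dots> = \<i> * wave k x * (\<Sum>j\<le>k. of_nat (k - j) * ?T j)"
      by (simp add: sum_distrib_left)
    finally have 1: "(\<Sum>j\<le>k. (coeff_dx 0 j t * wave j x) * (coeff_dx 1 (k - j) t * wave (k - j) x)) =
      \<i> * wave k x * (\<Sum>j\<le>k. of_nat (k - j) * ?T j)" .
    have "(\<Sum>j\<le>k. of_nat (k - j) * ?T j) = (\<Sum>j\<le>k. of_nat j * ?T j)"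
      by (rule sum.reindex_bij_witness[of _ "\<lambda>j. k - j" "\<lambda>j. k - j"]) (auto simp: mult.commute)
    then have "2 * (\<Sum>j\<le>k. of_nat (k - j) * ?T j) =
        (\<Sum>j\<le>k. of_nat (k - j) * ?T j) + (\<Sum>j\<le>k. of_nat j * ?T j)" by simp
    also have "\<dots> = (\<Sum>j\<le>k. of_nat k * ?T j)"
      unfolding sum.distrib[symmetric] by (rule sum.cong) (auto simp: of_nat_diff algebra_simps)
    finally have 2: "2 * (\<Sum>j\<le>k. of_nat (k - j) * ?T j) = of_nat k * (\<Sum>j\<le>k. ?T j)"
      by (simp add: sum_distrib_left)
    have "6 * (\<i> * wave k x * (\<Sum>j\<le>k. of_nat (k - j) * ?T j)) =
        3 * \<i> * wave k x * (2 * (\<Sum>j\<le>k. of_nat (k - j) * ?T j))" by simp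
    then show ?thesis unfolding 1 2 mode_source_alt by simp
  qed
  ultimately show ?thesis by (simp add: mult.assoc)
qed

lemma symb_alt: "symb \<alpha> \<nu> k = of_real \<nu> * (\<i> * of_nat k) ^ 2 - of_real \<alpha> * (\<i> * of_nat k) ^ 3"
  by (simp add: symb_def complex_eq_iff power2_eq_square power3_eq_cube)

lemma series_solves_pde:
  assumes t: "t > 0"
  shows "((\<lambda>s. series_dx 0 x s) has_vector_derivative
     6 * series_dx 0 x t * series_dx 1 x t - of_real \<alpha> * series_dx 3 x t + of_real \<nu> * series_dx 2 x t) (at t)"
proof -
  define f' where "f' k s = (symb \<alpha> \<nu> k * a k s + mode_source a k s) * wave k x" for k s
  have split: "f' k s = mode_source a k s * wave k x - of_real \<alpha> * (coeff_dx 3 k s * wave k x)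
      + of_real \<nu> * (coeff_dx 2 k s * wave k x)" for k s
    unfolding f'_def symb_alt coeff_dx_def by (simp add: algebra_simps)
  \<comment> \<open>One summand each for the source, the third and the second x-derivative of the
    series.\<close>
  let ?M = "\<lambda>k. 3 * B\<^sup>2 * (real k ^ 4 * r ^ k) + \<bar>\<alpha>\<bar> * (B * (real k ^ 4 * r ^ k)) + \<bar>\<nu>\<bar> * (B * (real k ^ 3 * r ^ k))"
  have "((\<lambda>s. \<Sum>k. coeff_dx 0 k s * wave k x) has_vector_derivative (\<Sum>k. f' k t)) (at t)"
  proof (rule has_vector_derivative_suminf[where S="{0<..}" and M="?M"])
    show "summable ?M"
      by (intro summable_add summable_mult summable_power_mult_geometric r)
    fix k and s :: real assume s: "s \<in> {0<..}"
    have "(a k has_vector_derivative symb \<alpha> \<nu> k * a k s + mode_source a k s) (at s)"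
      using mode_systemD(3)[OF sys, of s k] s at_within_interior[of s "{0..}"] by simp
    then show "((\<lambda>s. coeff_dx 0 k s * wave k x) has_vector_derivative f' k s) (at s)"
      unfolding f'_def coeff_dx_def by (auto intro: has_vector_derivative_mult_left)
    have "norm (f' k s) \<le> cmod (mode_source a k s) + \<bar>\<alpha>\<bar> * cmod (coeff_dx 3 k s) + \<bar>\<nu>\<bar> * cmod (coeff_dx 2 k s)"
      unfolding split by (rule order_trans[OF norm_triangle_ineq] add_mono order_trans[OF norm_triangle_ineq4])+
        (simp_all add: norm_mult)
    also have "\<dots> \<le> ?M k"
      using norm_mode_source[of s k] norm_coeff_dx[of s 3 k] norm_coeff_dx[of s 2 k] s
      by (intro add_mono mult_left_mono) (auto simp: eval_nat_numeral)
    finally show "norm (f' k s) \<le> ?M k" .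
    show "summable (\<lambda>k. coeff_dx 0 k s * wave k x)" using summable_series_dx s by simp
  qed (use t in auto)
  moreover have "f' k t = mode_source a k t * wave k x - of_real \<alpha> * (coeff_dx 3 k t * wave k x)
      + of_real \<nu> * (coeff_dx 2 k t * wave k x)" for k by (rule split)
  moreover have "(\<lambda>k. mode_source a k t * wave k x - of_real \<alpha> * (coeff_dx 3 k t * wave k x)
      + of_real \<nu> * (coeff_dx 2 k t * wave k x)) sums
      (6 * series_dx 0 x t * series_dx 1 x t - of_real \<alpha> * series_dx 3 x t + of_real \<nu> * series_dx 2 x t)"
    using t unfolding series_dx_def[of 3] series_dx_def[of 2]
    by (intro sums_add sums_diff sums_mult series_burgers summable_sums summable_series_dx) auto
  ultimately show ?thesis by (simp add: series_dx_def[of 0] sums_iff)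
qed

lemma series_initial: "series_dx 0 x 0 = A * wave 1 x"
proof -
  have "coeff_dx 0 k 0 * wave k x = (if k = 1 then A * wave 1 x else 0)" for k
    using mode_systemD(2)[OF sys, of k] by (simp add: coeff_dx_def)
  then show ?thesis
    unfolding series_dx_def using sums_single[of 1 "\<lambda>_. A * wave 1 x"] by (simp add: sums_iff)
qed

lemma series_global_solution:
  assumes "\<And>x. u0 x = A * exp (\<i> * of_real x)"
  shows "global_solution \<alpha> \<nu> u0 (series_dx 0)"
  unfolding global_solution_def
proof (intro conjI exI allI impI)
  show "series_dx 0 (x + 2 * pi) t = series_dx 0 x t" for x t
    by (simp add: series_dx_def wave_periodic)
  show "series_dx 0 x 0 = u0 x" for x by (simp add: series_initial assms wave_def)
  show "((\<lambda>y. series_dx 0 y t) has_vector_derivative series_dx 1 x t) (at x)"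
    "((\<lambda>y. series_dx 1 y t) has_vector_derivative series_dx 2 x t) (at x)"
    "((\<lambda>y. series_dx 2 y t) has_vector_derivative series_dx 3 x t) (at x)" if "t \<ge> 0" for t x
    using series_dx_has_vector_derivative[OF that, of _ x] by (simp_all add: eval_nat_numeral)
  show "((\<lambda>s. series_dx 0 x s) has_vector_derivative
     6 * series_dx 0 x t * series_dx 1 x t - of_real \<alpha> * series_dx 3 x t + of_real \<nu> * series_dx 2 x t) (at t)"
    if "t > 0" for t x by (rule series_solves_pde[OF that])
qed (simp_all add: series_dx_continuous)

lemma series_fourier:
  assumes "t \<ge> 0"
  shows "has_positive_fourier_series (\<lambda>x. series_dx 0 x t) (\<lambda>k. a k t)"
  unfolding has_positive_fourier_series_def
proof
  fix x
  have "((\<lambda>k. coeff_dx 0 k t * wave k x) has_sum series_dx 0 x t) UNIV"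
    unfolding series_dx_def
    by (intro norm_summable_imp_has_sum summable_norm_series_dx summable_sums summable_series_dx assms)
  moreover have "coeff_dx 0 k t * wave k x = a k t * exp (\<i> * of_nat k * of_real x)" for k
    by (simp add: coeff_dx_def wave_def)
  ultimately have "((\<lambda>k. a k t * exp (\<i> * of_nat k * of_real x)) has_sum series_dx 0 x t) UNIV"
    by simp
  \<comment> \<open>The index 0 may be dropped because \<open>a 0\<close> = 0.\<close>
  then show "((\<lambda>k. a k t * exp (\<i> * of_nat k * of_real x)) has_sum series_dx 0 x t) {1..}"
    by (rule has_sum_cong_neutral[THEN iffD1, rotated 3])
      (use mode_systemD(1)[OF sys] in \<open>auto simp: not_le\<close>)
qed

lemma series_in_Hs:
  assumes t: "t \<ge> 0"
  shows "in_Hs s (\<lambda>x. series_dx 0 x t)"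
proof -
  let ?f = "\<lambda>k. (1 + (real k)\<^sup>2) powr s * (cmod (a k t))\<^sup>2"
  \<comment> \<open>A natural exponent makes the weight polynomial: 1 + k^2 \<le> 2 k^2 for k \<ge>
    1, while the term k = 0 vanishes with \<open>a 0\<close>.\<close>
  obtain n :: nat where n: "s \<le> real n" using real_arch_simple by blast
  have "?f k \<le> 2 ^ n * B\<^sup>2 * (real k ^ (2 * n + 2) * (r\<^sup>2) ^ k)" for k
  proof (cases "k = 0")
    case True
    then show ?thesis using mode_systemD(1)[OF sys] by simp
  next
    case False
    then have k: "1 \<le> (real k)\<^sup>2" by simp
    have "(1 + (real k)\<^sup>2) powr s \<le> (1 + (real k)\<^sup>2) powr real n"
      using n by (intro powr_mono) auto
    also have "\<dots> = (1 + (real k)\<^sup>2) ^ n" by (rule powr_realpow) (simp add: add_pos_nonneg)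
    also have "\<dots> \<le> (2 * (real k)\<^sup>2) ^ n" using k by (intro power_mono) auto
    finally have 1: "(1 + (real k)\<^sup>2) powr s \<le> 2 ^ n * real k ^ (2 * n)"
      by (simp add: power_mult_distrib power_mult)
    have "(cmod (a k t))\<^sup>2 \<le> (B * real k * r ^ k)\<^sup>2"
      using decay[OF t] by (intro power_mono) auto
    then have "?f k \<le> 2 ^ n * real k ^ (2 * n) * (B * real k * r ^ k)\<^sup>2"
      using 1 by (intro mult_mono) auto
    also have "\<dots> = 2 ^ n * B\<^sup>2 * (real k ^ (2 * n + 2) * (r\<^sup>2) ^ k)"
      by (simp add: power_mult_distrib power_add power2_eq_square ac_simps)
    finally show ?thesis .
  qed
  moreover have "r\<^sup>2 < 1" using r by (simp add: power_less_one_iff)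
  then have "summable (\<lambda>k. 2 ^ n * B\<^sup>2 * (real k ^ (2 * n + 2) * (r\<^sup>2) ^ k))"
    by (intro summable_mult summable_power_mult_geometric) auto
  ultimately have "summable ?f"
    by (intro summable_comparison_test[OF _ \<open>summable _\<close>]) (auto intro!: exI[of _ 0])
  then have "?f summable_on UNIV" by (rule summable_nonneg_imp_summable_on) auto
  then have "?f summable_on {1..}" by (rule summable_on_subset_banach) auto
  then show ?thesis unfolding in_Hs_def using series_fourier[OF t] by blast
qed

end

lemma integral_fourier_mode: "integral {0..2*pi} (\<lambda>x. A * exp (\<i> * of_real x)) = 0"
proof -
  have "((\<lambda>x. A * exp (\<i> * of_real x)) has_integral
      (- \<i> * A * wave 1 (2 * pi)) - (- \<i> * A * wave 1 0)) {0..2*pi}"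
  proof (rule fundamental_theorem_of_calculus)
    fix x :: real
    have "((\<lambda>x. - \<i> * A * wave 1 x) has_vector_derivative - \<i> * A * (\<i> * of_nat 1 * wave 1 x)) (at x within {0..2*pi})"
      by (intro has_vector_derivative_mult_right has_vector_derivative_at_within[OF wave_has_vector_derivative])
    then show "((\<lambda>x. - \<i> * A * wave 1 x) has_vector_derivative A * exp (\<i> * of_real x)) (at x within {0..2*pi})"
      by (simp add: wave_def algebra_simps)
  qed auto
  then have "((\<lambda>x. A * exp (\<i> * of_real x)) has_integral 0) {0..2*pi}"
    using wave_periodic[of 1 0] by simp
  then show ?thesis by (rule integral_unique)
qed

theorem theorem3p5:
  fixes \<nu> \<alpha> :: real and a01 :: complex and u0 :: "real \<Rightarrow> complex"
  assumes "\<nu> \<ge> 0" and "\<alpha> \<ge> 0" and "\<nu>\<^sup>2 + 4 * \<alpha>\<^sup>2 \<ge> 9"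
    and "\<And>x. u0 x = a01 * exp (\<i> * of_real x)"
    and "cmod a01 < 1"
  shows "\<exists>u. global_solution \<alpha> \<nu> u0 u \<and>
           (\<forall>v. global_solution \<alpha> \<nu> u0 v \<longrightarrow> (\<forall>t\<ge>0. \<forall>x. v x t = u x t)) \<and>
           (\<exists>a :: nat \<Rightarrow> real \<Rightarrow> complex.
              \<forall>t\<ge>0. has_positive_fourier_series (\<lambda>x. u x t) (\<lambda>k. a k t)) \<and>
           (\<forall>s\<ge>0. \<forall>t\<ge>0. in_Hs s (\<lambda>x. u x t))"
proof -
  obtain a where a: "mode_system \<alpha> \<nu> a01 a" using mode_system_exists by blast
  \<comment> \<open>The decay ratio is \<open>cmod a01\<close> itself, so the hypothesis on the
    datum is precisely r < 1.\<close>
  interpret mode_decay \<alpha> \<nu> "cmod a01" "1 + \<alpha> / 2 + \<nu> / 3" a01 a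
    by standard (use assms mode_bound[OF a] a in auto)
  have sol: "global_solution \<alpha> \<nu> u0 (series_dx 0)" by (rule series_global_solution) (rule assms)
  have mean: "integral {0..2*pi} u0 = 0"
    using integral_fourier_mode[of a01] assms(4) by presburger
  \<comment> \<open>If both parameters vanished, the hypothesis would say 0 \<ge> 9.\<close>
  have "\<nu> > 0 \<or> \<alpha> \<noteq> 0" using assms(1,3) by (cases "\<nu> = 0"; cases "\<alpha> = 0") auto
  then have "\<forall>v. global_solution \<alpha> \<nu> u0 v \<longrightarrow> (\<forall>t\<ge>0. \<forall>x. v x t = series_dx 0 x t)"
    using global_solution_unique[OF sol _ mean assms(1)] by blast
  then show ?thesis using sol series_fourier series_in_Hs by blast
qed

end
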